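(* Let $N\ge 1$ and $n\ge 3$ be integers. Then the coupled half-space problem is uniquely solvable for given values of the characteristics $r_-^i$, $i=1,\ldots,n$, on all edges. That is: for every $(r_-^1,\ldots,r_-^n)\in\mathbb{R}^n$ there exists exactly one family $(G^1,\ldots,G^n)$ of bounded continuously differentiable functions $G^i=(g_0^i,g_1^i,\ldots,g_{2N-1}^i)^T:[0,\infty)\to\mathbb{R}^{2N}$ such that (i) for each $i=1,\ldots,n$, $A\,\partial_x G^i(x)=Q\,G^i(x)$ for all $x\ge 0$; (ii) for each $i=1,\ldots,n$, $q^i_\infty-a\rho^i_\infty=r_-^i$, where $\rho^i_\infty=\sqrt{2}\,\lim_{x\to\infty}g^i_0(x)$ and $q^i_\infty=\sqrt{2}\,\alpha_1\lim_{x\to\infty}g^i_1(x)$; (iii) the vectors $f^i(0)=(f^i_1(0),\ldots,f^i_{2N}(0))^T:=S^{-1}G^i(0)$ satisfy the symmetric kinetic coupling conditions $$\sum_{j=1}^n f^j_{2N-k+1}(0)=\sum_{j=1}^n f^j_k(0),\qquad k=1,\ldots,N,$$ $$(n-1)f^1_{2N-k+1}(0)+f^1_k(0)=(n-1)f^i_{2N-k+1}(0)+f^i_k(0),\qquad k=1,\ldots,N,\ i=2,\ldots,n.$$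
   Context: Legendre polynomials: for $k\ge 1$ let $\alpha_k=\frac{k}{\sqrt{(2k-1)(2k+1)}}$. The orthonormal Legendre polynomials on $[-1,1]$ are $P_0=\frac{1}{\sqrt2}$, $P_1(v)=\sqrt{\tfrac32}\,v$, and $vP_k=\alpha_{k+1}P_{k+1}+\alpha_kP_{k-1}$ for $k\ge 1$. Discrete velocities: $-1\le v_1<\cdots<v_N<0<v_{N+1}<\cdots<v_{2N}\le 1$ are the $2N$ Gauss-Legendre points, i.e. the zeros of $P_{2N}$; they satisfy $v_{2N-k+1}=-v_k$. $S\in\mathbb{R}^{2N\times 2N}$ is the (invertible) Vandermonde-like matrix with entries $S_{j+1,i}=P_j(v_i)$, $j=0,\ldots,2N-1$, $i=1,\ldots,2N$. It transforms discrete distribution functions $f=(f_1,\ldots,f_{2N})^T$ into moments $G=Sf=(g_0,\ldots,g_{2N-1})^T$. The density is $\rho=\sum_i f_i=\sqrt2\,g_0$ and the mean flux is $q=\sum_i v_if_i=\sqrt2\,\alpha_1 g_1$. $a=\alpha_1=\frac{1}{\sqrt3}$. $A\in\mathbb{R}^{2N\times 2N}$ is the symmetric tridiagonal matrix with zero diagonal and off-diagonal entries $A_{k,k+1}=A_{k+1,k}=\alpha_k$, $k=1,\ldots,2N-1$. $Q=\mathrm{diag}(0,0,-1,\ldots,-1)\in\mathbb{R}^{2N\times 2N}$ (two zeros followed by $2N-2$ entries $-1$). For bounded solutions of $A\partial_xG=QG$ on $[0,\infty)$ the limits $\lim_{x\to\infty}g_0(x)$ and $\lim_{x\to\infty}g_1(x)$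 exist. The integer $n$ is the number of edges meeting at a node of a network, each edge being oriented away from the node, which is located at $x=0$; the upper index $i$ refers to the edge. The conditions in (iii) are the form, for $\beta_{ij}=\frac{1}{n-1}$ ($i\ne j$), $\beta_{ii}=0$, of the kinetic coupling conditions $f^i(0,v)=\sum_{j}\beta_{ij}f^j(0,-v)$, $v>0$, at the discrete velocities. *)

theory Defs
  imports Complex_Main "HOL-Library.FuncSet" "HOL-Computational_Algebra.Polynomial"
    "Jordan_Normal_Form.Gauss_Jordan_Elimination"
begin

text \<open>Vectors and matrices are those of the AFP entry on Jordan normal forms, with entries numbered
  from 0; \<open>\<alpha>\<^sub>k\<close>, velocities and edges keep their numbering from 1.\<close>

definition alpha :: "nat \<Rightarrow> real" where
  "alpha k = real k / sqrt ((2 * real k - 1) * (2 * real k + 1))"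

fun legendre :: "nat \<Rightarrow> real poly" where
  "legendre 0 = [:1 / sqrt 2:]"
| "legendre (Suc 0) = [:0, sqrt (3 / 2):]"
| "legendre (Suc (Suc k)) =
     Polynomial.smult (1 / alpha (k + 2)) ([:0, 1:] * legendre (k + 1) - Polynomial.smult (alpha (k + 1)) (legendre k))"

lemma alpha_pos: "k \<ge> 1 \<Longrightarrow> alpha k > 0"
  unfolding alpha_def by (intro divide_pos_pos real_sqrt_gt_zero mult_pos_pos) auto

lemma alpha_1: "alpha 1 = 1 / sqrt 3"
  by (simp add: alpha_def)

lemma legendre_recurrence:
  assumes "k \<ge> 1"
  shows "[:0, 1:] * legendre k =
    Polynomial.smult (alpha (k + 1)) (legendre (k + 1)) + Polynomial.smult (alpha k) (legendre (k - 1))"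
proof -
  obtain m where k: "k = Suc m" using assms by (cases k) auto
  have "alpha (Suc (Suc m)) \<noteq> 0" using alpha_pos[of "Suc (Suc m)"] by simp
  thus ?thesis by (simp add: k)
qed

text \<open>The Gauss--Legendre points \<open>v\<^sub>1 < \<dots> < v\<^sub>2\<^sub>N\<close>, i.e. the zeros of the polynomial of
  degree \<open>2N\<close> in increasing order.\<close>

definition velocity :: "nat \<Rightarrow> nat \<Rightarrow> real" where
  "velocity N i = sorted_list_of_set {x. poly (legendre (2 * N)) x = 0} ! (i - 1)"

definition S_mat :: "nat \<Rightarrow> real mat" where
  "S_mat N = mat (2 * N) (2 * N) (\<lambda>(j, i). poly (legendre j) (velocity N (i + 1)))"

definition A_mat :: "nat \<Rightarrow> real mat" where
  "A_mat N = mat (2 * N) (2 * N)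
     (\<lambda>(i, j). if j = i + 1 then alpha j else if i = j + 1 then alpha i else 0)"

definition Q_mat :: "nat \<Rightarrow> real mat" where
  "Q_mat N = mat (2 * N) (2 * N) (\<lambda>(i, j). if i = j \<and> 2 \<le> i then - 1 else 0)"

text \<open>Derivatives are componentwise and relative to the half line, hence one-sided at 0.\<close>

definition has_halfline_deriv :: "nat \<Rightarrow> (real \<Rightarrow> real vec) \<Rightarrow> (real \<Rightarrow> real vec) \<Rightarrow> bool" where
  "has_halfline_deriv d G G' \<longleftrightarrow>
     (\<forall>x\<ge>0. G' x \<in> carrier_vec d) \<and>
     (\<forall>j<d. \<forall>x\<ge>0. ((\<lambda>y. G y $ j) has_real_derivative G' x $ j) (at x within {0..}))"

text \<open>Bounded continuously differentiable solutions of \<open>A G' = Q G\<close> on \<open>[0, \<infinity>)\<close>.\<close>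

definition bounded_solution :: "nat \<Rightarrow> (real \<Rightarrow> real vec) \<Rightarrow> bool" where
  "bounded_solution N G \<longleftrightarrow>
     (\<forall>x\<ge>0. G x \<in> carrier_vec (2 * N)) \<and>
     (\<exists>B. \<forall>x\<ge>0. \<forall>j<2 * N. \<bar>G x $ j\<bar> \<le> B) \<and>
     (\<exists>G'. has_halfline_deriv (2 * N) G G' \<and>
           (\<forall>j<2 * N. continuous_on {0..} (\<lambda>x. G' x $ j)) \<and>
           (\<forall>x\<ge>0. A_mat N *\<^sub>v G' x = Q_mat N *\<^sub>v G x))"

text \<open>\<open>Lim\<close> is total; for bounded solutions the two limits exist.\<close>

definition rho_inf :: "(real \<Rightarrow> real vec) \<Rightarrow> real" where
  "rho_inf G = sqrt 2 * Lim at_top (\<lambda>x. G x $ 0)"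

definition q_inf :: "(real \<Rightarrow> real vec) \<Rightarrow> real" where
  "q_inf G = sqrt 2 * alpha 1 * Lim at_top (\<lambda>x. G x $ 1)"

text \<open>The component \<open>f\<^sub>k(0)\<close>, \<open>k = 1, \<dots>, 2N\<close>, of \<open>f(0) = S\<^sup>-\<^sup>1 G(0)\<close>; the matrix \<open>S\<close> is
  invertible, so \<open>mat_inverse\<close> is not \<open>None\<close>.\<close>

definition node_dist :: "nat \<Rightarrow> (real \<Rightarrow> real vec) \<Rightarrow> nat \<Rightarrow> real" where
  "node_dist N G k = (the (mat_inverse (S_mat N)) *\<^sub>v G 0) $ (k - 1)"

definition kinetic_coupling :: "nat \<Rightarrow> nat \<Rightarrow> (nat \<Rightarrow> real \<Rightarrow> real vec) \<Rightarrow> bool" where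
  "kinetic_coupling N n G \<longleftrightarrow>
     (\<forall>k\<in>{1..N}. (\<Sum>j=1..n. node_dist N (G j) (2 * N - k + 1)) = (\<Sum>j=1..n. node_dist N (G j) k)) \<and>
     (\<forall>k\<in>{1..N}. \<forall>i\<in>{2..n}.
        (real n - 1) * node_dist N (G 1) (2 * N - k + 1) + node_dist N (G 1) k =
        (real n - 1) * node_dist N (G i) (2 * N - k + 1) + node_dist N (G i) k)"

end

theory Submission
  imports Defs "HOL-Computational_Algebra.Fundamental_Theorem_Algebra" "Jordan_Normal_Form.Determinant"
begin

text \<open>Diagonalising the trailing \<open>(2N - 2)\<close>-dimensional block of \<open>A\<close>, whose spectrum is simple and
  symmetric about 0 without containing 0, shows that the bounded solutions of \<open>A G' = Q G\<close> are exactly the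
  combinations of the two constant modes and of \<open>N - 1\<close> decaying modes, a space of dimension \<open>N + 1\<close>.

  The coupling conditions split: the sum of all \<open>f\<^sup>j\<close> satisfies \<open>f\<^sub>2\<^sub>N\<^sub>-\<^sub>k\<^sub>+\<^sub>1 = \<kappa> f\<^sub>k\<close> with
  \<open>\<kappa> = 1\<close>, the differences \<open>f\<^sup>1 - f\<^sup>i\<close> satisfy it with \<open>\<kappa> = - 1 / (n - 1)\<close>. For \<open>\<bar>\<kappa>\<bar> \<le> 1\<close> such a
  half-space problem with \<open>r\<^sub>- = 0\<close> has only the trivial solution: the quadratic form \<open>G(0) \<cdot> A G(0)\<close> is
  \<open>\<Sum>\<^sub>k v\<^sub>k h\<^sub>k f\<^sub>k\<^sup>2 \<le> 0\<close> by the reflection condition (with positive \<open>h\<^sub>k\<close>), while in terms of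
  the modes it is \<open>2 \<alpha>\<^sub>1 g\<^sub>0(\<infinity>) g\<^sub>1(\<infinity>)\<close> plus a positive definite form in the decaying modes, and
  \<open>r\<^sub>- = 0\<close> means \<open>g\<^sub>0(\<infinity>) = g\<^sub>1(\<infinity>)\<close>. The problem amounts to \<open>N + 1\<close> linear equations for
  \<open>N + 1\<close> coefficients, so uniqueness implies solvability.\<close>

section \<open>Polynomials of a Jacobi matrix\<close>

text \<open>At a root \<open>x\<close> of the \<open>m\<close>-th polynomial, the values at
  \<open>x\<close> of those before it form an eigenvector of the Jacobi matrix of size
  \<open>m\<close> with off-diagonal entries \<open>a 1\<close>, \<open>a 2\<close>, ... The field
  is general because the roots are first located over the complex numbers.\<close>

fun jacobi_poly :: "(nat \<Rightarrow> 'a :: field) \<Rightarrow> nat \<Rightarrow> 'a poly" where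
  "jacobi_poly a 0 = 1"
| "jacobi_poly a (Suc 0) = [:0, 1 / a 1:]"
| "jacobi_poly a (Suc (Suc k)) = Polynomial.smult (1 / a (k + 2))
     ([:0, 1:] * jacobi_poly a (Suc k) - Polynomial.smult (a (Suc k)) (jacobi_poly a k))"

lemma poly_jacobi_poly_minus:
  "poly (jacobi_poly a k) (- x) = (- 1) ^ k * poly (jacobi_poly a k) x"
  by (induction a k rule: jacobi_poly.induct) (simp_all add: algebra_simps)

context
  fixes a :: "nat \<Rightarrow> 'a :: field"
  assumes a_nz: "\<forall>k\<ge>1. a k \<noteq> 0"
begin

lemma jacobi_poly_Suc0: "a (Suc 0) * poly (jacobi_poly a (Suc 0)) x = x"
  using a_nz[rule_format, of 1] by simp

lemma jacobi_poly_rec: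
  "a (Suc (Suc k)) * poly (jacobi_poly a (Suc (Suc k))) x =
     x * poly (jacobi_poly a (Suc k)) x - a (Suc k) * poly (jacobi_poly a k) x"
  using a_nz[rule_format, of "Suc (Suc k)"] by simp

lemma jacobi_poly_pderiv_rec:
  "a (Suc (Suc k)) * poly (pderiv (jacobi_poly a (Suc (Suc k)))) x =
     poly (jacobi_poly a (Suc k)) x + x * poly (pderiv (jacobi_poly a (Suc k))) x
       - a (Suc k) * poly (pderiv (jacobi_poly a k)) x"
  using a_nz[rule_format, of "Suc (Suc k)"] by (simp add: pderiv_smult pderiv_diff pderiv_mult pderiv_pCons)

lemma degree_jacobi_poly: "degree (jacobi_poly a k) = k"
proof (induction k rule: less_induct)
  case (less k)
  consider "k = 0" | "k = 1" | l where "k = Suc (Suc l)"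
    by (metis One_nat_def not0_implies_Suc)
  then show ?case
  proof cases
    case 3
    have "degree ([:0, 1:] * jacobi_poly a (Suc l)) = Suc (Suc l)"
      using less[of "Suc l"] 3 by (subst degree_mult_eq) auto
    moreover have "degree (Polynomial.smult (a (Suc l)) (jacobi_poly a l)) < Suc (Suc l)"
      using less[of l] 3 by (simp add: degree_smult_eq)
    ultimately show ?thesis
      using a_nz[rule_format, of "l + 2"] 3 degree_add_eq_left[of "- Polynomial.smult (a (Suc l)) (jacobi_poly a l)" "[:0, 1:] * jacobi_poly a (Suc l)"]
      by (simp del: mult_pCons_left)
  qed (use a_nz[rule_format, of 1] in auto)
qed

text \<open>Multiplying the recurrence at \<open>x\<close> by the preceding polynomial at
  \<open>y\<close>, and subtracting the same with \<open>x\<close> and \<open>y\<close> exchanged,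
  adds exactly the next summand.\<close>

lemma christoffel_darboux:
  "(x - y) * (\<Sum>j\<le>k. poly (jacobi_poly a j) x * poly (jacobi_poly a j) y) =
     a (Suc k) * (poly (jacobi_poly a (Suc k)) x * poly (jacobi_poly a k) y
       - poly (jacobi_poly a k) x * poly (jacobi_poly a (Suc k)) y)"
proof (induction k)
  case 0
  then show ?case using a_nz[rule_format, of 1] by (simp add: field_simps)
next
  case (Suc k)
  have "a (Suc (Suc k)) * (poly (jacobi_poly a (Suc (Suc k))) x * poly (jacobi_poly a (Suc k)) y
       - poly (jacobi_poly a (Suc k)) x * poly (jacobi_poly a (Suc (Suc k))) y) =
     (a (Suc (Suc k)) * poly (jacobi_poly a (Suc (Suc k))) x) * poly (jacobi_poly a (Suc k)) y
       - poly (jacobi_poly a (Suc k)) x * (a (Suc (Suc k)) * poly (jacobi_poly a (Suc (Suc k))) y)"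
    by (simp only: algebra_simps)
  then show ?case
    unfolding jacobi_poly_rec using Suc by (simp only: sum.atMost_Suc) (simp add: algebra_simps del: jacobi_poly.simps)
qed

text \<open>At two roots the right-hand side of Christoffel-Darboux vanishes: eigenvectors of
  distinct eigenvalues are orthogonal.\<close>

lemma jacobi_poly_orthogonal:
  assumes "poly (jacobi_poly a m) x = 0" "poly (jacobi_poly a m) y = 0" "x \<noteq> y"
  shows "(\<Sum>j<m. poly (jacobi_poly a j) x * poly (jacobi_poly a j) y) = 0"
proof (cases m)
  case (Suc k)
  then show ?thesis using christoffel_darboux[of x y k] assms
    by (simp add: lessThan_Suc_atMost del: jacobi_poly.simps)
qed simp

text \<open>At 0 the recurrence links degrees of equal parity by a nonzero factor. This excludes the
  eigenvalue 0 for Jacobi matrices of even size.\<close>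

lemma poly_jacobi_poly_even_0: "poly (jacobi_poly a (2 * k)) 0 \<noteq> 0"
proof (induction k)
  case (Suc k)
  then show ?case using jacobi_poly_rec[of "2 * k" 0] a_nz[rule_format, of "Suc (2*k)"]
    by (auto simp del: jacobi_poly.simps)
qed simp

end

section \<open>Reality and simplicity of the roots\<close>

context
  fixes a :: "nat \<Rightarrow> real"
  assumes a_pos: "\<forall>k\<ge>1. a k > 0"
begin

lemma coeffs_neq_0: "\<forall>k\<ge>1. a k \<noteq> 0"
  using a_pos by force

lemma complex_coeffs_neq_0: "\<forall>k\<ge>1. complex_of_real (a k) \<noteq> 0"
  using a_pos by force

text \<open>Confluent Christoffel-Darboux: \<open>a (Suc k)\<close> times this Wronskian is the sum
  of the squares of the polynomials up to \<open>k\<close>. Its positivity forbids double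
  roots.\<close>

lemma jacobi_poly_wronskian_pos:
  "poly (pderiv (jacobi_poly a (Suc k))) x * poly (jacobi_poly a k) x
     - poly (jacobi_poly a (Suc k)) x * poly (pderiv (jacobi_poly a k)) x > 0"
proof (induction k)
  case 0
  then show ?case using a_pos[rule_format, of 1] by (simp add: pderiv_pCons)
next
  case (Suc k)
  let ?p = "\<lambda>k. poly (jacobi_poly a k) x" and ?d = "\<lambda>k. poly (pderiv (jacobi_poly a k)) x"
  have "a (Suc (Suc k)) * (?d (Suc (Suc k)) * ?p (Suc k) - ?p (Suc (Suc k)) * ?d (Suc k)) =
    (a (Suc (Suc k)) * ?d (Suc (Suc k))) * ?p (Suc k) - (a (Suc (Suc k)) * ?p (Suc (Suc k))) * ?d (Suc k)"
    by (simp only: algebra_simps)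
  also have "\<dots> = (?p (Suc k))\<^sup>2 + a (Suc k) * (?d (Suc k) * ?p k - ?p (Suc k) * ?d k)"
    unfolding jacobi_poly_rec[OF coeffs_neq_0] jacobi_poly_pderiv_rec[OF coeffs_neq_0]
    by (simp add: algebra_simps power2_eq_square del: jacobi_poly.simps)
  also have "\<dots> > 0"
    using Suc a_pos[rule_format, of "Suc k"] by (intro add_nonneg_pos mult_pos_pos) auto
  finally show ?case using a_pos[rule_format, of "Suc (Suc k)"] by (simp add: zero_less_mult_iff del: jacobi_poly.simps)
qed

text \<open>Christoffel-Darboux with \<open>y\<close> the conjugate of \<open>z\<close>: up to the
  factor \<open>a (Suc k)\<close> this is \<open>Im z\<close> times a sum of squared moduli. So no
  root lies in the upper half-plane.\<close>

lemma jacobi_poly_complex_Im: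
  assumes "Im z > 0"
  shows "Im (poly (jacobi_poly (\<lambda>k. complex_of_real (a k)) (Suc k)) z
           * cnj (poly (jacobi_poly (\<lambda>k. complex_of_real (a k)) k) z)) > 0"
proof (induction k)
  case 0
  then show ?case using a_pos[rule_format, of 1] assms by (simp add: Im_divide_of_real)
next
  case (Suc k)
  let ?p = "\<lambda>k. poly (jacobi_poly (\<lambda>k. complex_of_real (a k)) k) z"
  have "a (Suc (Suc k)) * Im (?p (Suc (Suc k)) * cnj (?p (Suc k))) =
     Im ((complex_of_real (a (Suc (Suc k))) * ?p (Suc (Suc k))) * cnj (?p (Suc k)))"
    by (simp only: mult.assoc Im_complex_of_real Re_complex_of_real mult_zero_left add_0_right times_complex.simps)
  also have "\<dots> = Im z * (cmod (?p (Suc k)))\<^sup>2 + a (Suc k) * Im (?p (Suc k) * cnj (?p k))"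
    unfolding jacobi_poly_rec[OF complex_coeffs_neq_0] cmod_power2
    by (simp add: algebra_simps power2_eq_square del: jacobi_poly.simps)
  also have "\<dots> > 0"
    using Suc a_pos[rule_format, of "Suc k"] assms by (intro add_nonneg_pos mult_pos_pos) auto
  finally show ?case using a_pos[rule_format, of "Suc (Suc k)"] by (simp add: zero_less_mult_iff del: jacobi_poly.simps)
qed

lemma jacobi_poly_cnj:
  "poly (jacobi_poly (\<lambda>k. complex_of_real (a k)) k) (cnj z) = cnj (poly (jacobi_poly (\<lambda>k. complex_of_real (a k)) k) z)"
  by (induction a k rule: jacobi_poly.induct) auto

lemma jacobi_poly_of_real:
  "poly (jacobi_poly (\<lambda>k. complex_of_real (a k)) k) (of_real x) = of_real (poly (jacobi_poly a k) x)"
  by (induction a k rule: jacobi_poly.induct) auto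

lemma jacobi_poly_pderiv_of_real:
  "poly (pderiv (jacobi_poly (\<lambda>k. complex_of_real (a k)) k)) (of_real x)
     = of_real (poly (pderiv (jacobi_poly a k)) x)"
proof (induction k rule: induct_nat_012)
  case (ge2 k)
  have "complex_of_real (a (Suc (Suc k))) * poly (pderiv (jacobi_poly (\<lambda>k. complex_of_real (a k)) (Suc (Suc k)))) (of_real x)
    = of_real (a (Suc (Suc k)) * poly (pderiv (jacobi_poly a (Suc (Suc k)))) x)"
    unfolding jacobi_poly_pderiv_rec[OF complex_coeffs_neq_0] jacobi_poly_pderiv_rec[OF coeffs_neq_0]
    by (simp only: ge2 jacobi_poly_of_real of_real_add of_real_diff of_real_mult)
  then show ?case using a_pos[rule_format, of "Suc (Suc k)"] by (simp del: jacobi_poly.simps)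
qed (simp_all add: pderiv_pCons)

lemma jacobi_poly_roots_real:
  assumes "poly (jacobi_poly (\<lambda>k. complex_of_real (a k)) k) z = 0"
  shows "Im z = 0"
proof (cases k)
  case (Suc l)
  have "\<not> Im w > 0" if "poly (jacobi_poly (\<lambda>k. complex_of_real (a k)) k) w = 0" for w
    using jacobi_poly_complex_Im[of w l] that Suc by auto
  from this[of z] this[of "cnj z"] assms show ?thesis by (auto simp: jacobi_poly_cnj)
qed (use assms in simp)

text \<open>All complex roots are real, and the Wronskian makes them simple, so the factorisation
  over the complex numbers has as many distinct roots as the degree.\<close>

lemma card_jacobi_poly_roots: "card {x. poly (jacobi_poly a k) x = 0} = k"
proof (cases k)
  case (Suc l)
  let ?q = "jacobi_poly (\<lambda>k. complex_of_real (a k)) k"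
  have roots: "{z. poly ?q z = 0} = complex_of_real ` {x. poly (jacobi_poly a k) x = 0}"
  proof (intro equalityI subsetI)
    fix z assume z: "z \<in> {z. poly ?q z = 0}"
    then have "z = of_real (Re z)" using jacobi_poly_roots_real by (simp add: complex_eq_iff)
    then show "z \<in> complex_of_real ` {x. poly (jacobi_poly a k) x = 0}"
      using z jacobi_poly_of_real[of k "Re z"] by force
  qed (auto simp: jacobi_poly_of_real)
  have "rsquarefree ?q"
    unfolding rsquarefree_roots
  proof (intro allI notI, elim conjE)
    fix z assume z: "poly ?q z = 0" "poly (pderiv ?q) z = 0"
    then obtain x where "z = of_real x" "poly (jacobi_poly a k) x = 0" using roots by blast
    then show False
      using z jacobi_poly_wronskian_pos[of l x] Suc
      by (simp add: jacobi_poly_pderiv_of_real del: jacobi_poly.simps)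
  qed
  then have "degree (Polynomial.smult (lead_coeff ?q) (\<Prod>z | poly ?q z = 0. [:- z, 1:])) = degree ?q"
    by (simp only: complex_poly_decompose_rsquarefree)
  moreover have "?q \<noteq> 0" using degree_jacobi_poly[OF complex_coeffs_neq_0, of k] Suc by force
  ultimately have "card {z. poly ?q z = 0} = degree ?q"
    by (simp add: degree_prod_sum_eq)
  then show ?thesis
    unfolding roots degree_jacobi_poly[OF complex_coeffs_neq_0] by (simp add: card_image inj_on_def)
qed simp

end

text \<open>The squared length of the eigenvector at \<open>x\<close>; at a root its reciprocal is a
  Gauss weight.\<close>

definition kernel_diag :: "(nat \<Rightarrow> real) \<Rightarrow> nat \<Rightarrow> real \<Rightarrow> real" where
  "kernel_diag a m x = (\<Sum>j<m. (poly (jacobi_poly a j) x)\<^sup>2)"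

lemma kernel_diag_pos: "m > 0 \<Longrightarrow> kernel_diag a m x > 0"
  unfolding kernel_diag_def by (rule sum_pos2[of _ 0]) auto

text \<open>Orthogonality of the eigenvectors makes the scaled transpose \<open>V\<close> a right
  inverse of the matrix \<open>U\<close> whose rows they are. For square matrices it is then also a
  left inverse, which is orthogonality over the roots.\<close>

lemma jacobi_poly_dual_orthogonal:
  fixes a :: "nat \<Rightarrow> real"
  assumes a_pos: "\<forall>k\<ge>1. a k > 0" and "j < m" "k < m"
  shows "(\<Sum>x | poly (jacobi_poly a m) x = 0.
            poly (jacobi_poly a j) x * poly (jacobi_poly a k) x / kernel_diag a m x) = (if j = k then 1 else 0)"
proof -
  let ?R = "{x. poly (jacobi_poly a m) x = 0}"
  let ?p = "\<lambda>j x. poly (jacobi_poly a j) x"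
  define xs where "xs = sorted_list_of_set ?R"
  have card: "card ?R = m" using card_jacobi_poly_roots[OF a_pos] .
  then have fin: "finite ?R" using assms(2) by (metis card.infinite not_less_zero)
  have bij: "bij_betw ((!) xs) {..<m} ?R"
    unfolding xs_def by (rule bij_betw_nth) (use fin card in simp_all)
  define U where "U = mat m m (\<lambda>(i, j). ?p j (xs ! i))"
  define V where "V = mat m m (\<lambda>(j, i). ?p j (xs ! i) / kernel_diag a m (xs ! i))"
  have "U * V = 1\<^sub>m m"
  proof (rule eq_matI)
    fix i l assume il: "i < dim_row (1\<^sub>m m)" "l < dim_col (1\<^sub>m m)"
    have root: "?p m (xs ! i) = 0" "?p m (xs ! l) = 0" using bij il by (auto simp: bij_betw_def)
    have "(U * V) $$ (i, l) = (\<Sum>j<m. ?p j (xs ! i) * ?p j (xs ! l)) / kernel_diag a m (xs ! l)"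
      using il by (simp add: U_def V_def scalar_prod_def sum_divide_distrib lessThan_atLeast0)
    also have "\<dots> = (if i = l then 1 else 0)"
    proof (cases "i = l")
      case True
      then show ?thesis using kernel_diag_pos[of m a "xs ! l"] assms(2)
        by (simp add: kernel_diag_def power2_eq_square)
    next
      case False
      then have "xs ! i \<noteq> xs ! l" using inj_on_eq_iff[OF bij_betw_imp_inj_on[OF bij], of i l] il by simp
      then have "(\<Sum>j<m. ?p j (xs ! i) * ?p j (xs ! l)) = 0"
        using jacobi_poly_orthogonal[OF coeffs_neq_0[OF a_pos] root] by blast
      with False show ?thesis by (simp only: div_0 if_False)
    qed
    finally show "(U * V) $$ (i, l) = 1\<^sub>m m $$ (i, l)" using il by simp
  qed (simp_all add: U_def V_def)
  then have "V * U = 1\<^sub>m m"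
    by (rule mat_mult_left_right_inverse[rotated 2]) (simp_all add: U_def V_def)
  then have "(V * U) $$ (j, k) = (if j = k then 1 else 0)"
    using assms by simp
  moreover have "(V * U) $$ (j, k) = (\<Sum>i<m. ?p j (xs ! i) * ?p k (xs ! i) / kernel_diag a m (xs ! i))"
    using assms by (simp add: U_def V_def scalar_prod_def lessThan_atLeast0)
  moreover have "(\<Sum>i<m. ?p j (xs ! i) * ?p k (xs ! i) / kernel_diag a m (xs ! i)) = (\<Sum>x\<in>?R. ?p j x * ?p k x / kernel_diag a m x)"
    by (rule sum.reindex_bij_betw[OF bij])
  ultimately show ?thesis by metis
qed

section \<open>Gauss--Legendre points\<close>

text \<open>Both sequences obey the same linear recurrence, and \<open>sqrt (3 / 2)\<close> is
  \<open>1 / sqrt 2\<close> times \<open>1 / alpha 1\<close>.\<close>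

lemma legendre_eq_jacobi_poly: "legendre k = Polynomial.smult (1 / sqrt 2) (jacobi_poly alpha k)"
proof (induction k rule: legendre.induct)
  case 2
  show ?case by (simp add: alpha_def real_sqrt_divide)
qed (simp_all add: smult_diff_right mult.commute)

lemma alpha_all_pos: "\<forall>k\<ge>1. alpha k > 0"
  using alpha_pos by blast

lemma legendre_roots: "{x. poly (legendre k) x = 0} = {x. poly (jacobi_poly alpha k) x = 0}"
  by (simp add: legendre_eq_jacobi_poly)

lemma poly_legendre_minus: "poly (legendre k) (- x) = (- 1) ^ k * poly (legendre k) x"
  by (simp add: legendre_eq_jacobi_poly poly_jacobi_poly_minus)

lemma card_legendre_roots: "card {x. poly (legendre k) x = 0} = k"
  unfolding legendre_roots by (rule card_jacobi_poly_roots[OF alpha_all_pos])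

lemma finite_legendre_roots: "finite {x. poly (legendre k) x = 0}"
proof (cases "k = 0")
  case False
  then show ?thesis using card_legendre_roots[of k] by (metis card.infinite)
qed simp

context
  fixes N :: nat
begin

lemma bij_betw_velocity: "bij_betw (velocity N) {1..2 * N} {x. poly (legendre (2 * N)) x = 0}"
proof -
  have "bij_betw (\<lambda>i. i - 1) {1..2 * N} {..<2 * N}"
    by (rule bij_betw_byWitness[of _ Suc]) auto
  moreover have "bij_betw ((!) (sorted_list_of_set {x. poly (legendre (2 * N)) x = 0})) {..<2 * N} {x. poly (legendre (2 * N)) x = 0}"
    by (rule bij_betw_nth) (simp_all add: card_legendre_roots finite_legendre_roots)
  ultimately show ?thesis
    unfolding velocity_def by (auto dest: bij_betw_trans simp: comp_def)
qed

lemma velocity_root: "k \<in> {1..2 * N} \<Longrightarrow> poly (legendre (2 * N)) (velocity N k) = 0"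
  using bij_betw_velocity by (auto simp: bij_betw_def)

text \<open>The polynomial being even, negating and reversing the sorted list of its roots gives a
  sorted list of the same set, hence the same list.\<close>

lemma velocity_reflect:
  assumes "k \<in> {1..2 * N}"
  shows "velocity N (2 * N - k + 1) = - velocity N k"
proof -
  let ?R = "{x. poly (legendre (2 * N)) x = 0}"
  let ?xs = "sorted_list_of_set ?R"
  have R: "uminus ` ?R = ?R"
  proof -
    have "x \<in> ?R \<Longrightarrow> - x \<in> ?R" for x by (simp add: poly_legendre_minus)
    then show ?thesis by force
  qed
  have "rev (map uminus ?xs) = ?xs"
  proof (rule sorted_distinct_set_unique)
    have "sorted_wrt (\<lambda>x y. - y \<le> - x) ?xs" by simp
    then have "sorted_wrt (\<lambda>x y. y \<le> x) (map uminus ?xs)"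
      unfolding sorted_wrt_map by simp
    then show "sorted (rev (map uminus ?xs))" by (simp add: sorted_wrt_rev)
    show "set (rev (map uminus ?xs)) = set ?xs"
      using R finite_legendre_roots[of "2 * N"] by simp
  qed (simp_all add: distinct_map)
  then have "?xs ! (2 * N - k) = rev (map uminus ?xs) ! (2 * N - k)" by simp
  also have "\<dots> = - (?xs ! (k - 1))"
    using assms by (subst rev_nth) (auto simp: card_legendre_roots)
  finally show ?thesis by (simp add: velocity_def)
qed

lemma velocity_strict_mono:
  assumes "1 \<le> i" "i < j" "j \<le> 2 * N"
  shows "velocity N i < velocity N j"
  unfolding velocity_def
  by (rule sorted_wrt_nth_less[OF strict_sorted_list_of_set]) (use assms in \<open>auto simp: card_legendre_roots\<close>)

lemma velocity_neg:
  assumes "k \<in> {1..N}"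
  shows "velocity N k < 0"
  using velocity_strict_mono[of k "2 * N - k + 1"] velocity_reflect[of k] assms by auto

text \<open>The reciprocal of the Gauss-Legendre weight at the velocity, and the squared length of
  the corresponding column of \<open>S_mat N\<close>.\<close>

definition kernel_at :: "nat \<Rightarrow> real" where
  "kernel_at k = (\<Sum>j<2 * N. (poly (legendre j) (velocity N k))\<^sup>2)"

lemma kernel_at_eq: "kernel_at k = kernel_diag alpha (2 * N) (velocity N k) / 2"
  by (simp add: kernel_at_def kernel_diag_def legendre_eq_jacobi_poly power_divide sum_divide_distrib)

lemma kernel_at_pos: "N \<ge> 1 \<Longrightarrow> kernel_at k > 0"
  unfolding kernel_at_eq using kernel_diag_pos[of "2 * N"] by simp

lemma kernel_at_reflect:
  assumes "k \<in> {1..2 * N}"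
  shows "kernel_at (2 * N - k + 1) = kernel_at k"
  unfolding kernel_at_def velocity_reflect[OF assms] poly_legendre_minus
  by (simp add: power_mult_distrib flip: power_mult)

lemma legendre_dual_orthogonal:
  assumes "j < 2 * N" "l < 2 * N"
  shows "(\<Sum>k=1..2 * N. poly (legendre j) (velocity N k) * poly (legendre l) (velocity N k) / kernel_at k)
    = (if j = l then 1 else 0)"
proof -
  have "(\<Sum>k=1..2 * N. poly (legendre j) (velocity N k) * poly (legendre l) (velocity N k) / kernel_at k)
    = (\<Sum>k=1..2 * N. poly (jacobi_poly alpha j) (velocity N k) * poly (jacobi_poly alpha l) (velocity N k) / kernel_diag alpha (2 * N) (velocity N k))"
    by (intro sum.cong) (simp_all add: legendre_eq_jacobi_poly kernel_at_eq)
  also have "\<dots> = (\<Sum>x | poly (jacobi_poly alpha (2 * N)) x = 0. poly (jacobi_poly alpha j) x * poly (jacobi_poly alpha l) x / kernel_diag alpha (2 * N) x)"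
    using sum.reindex_bij_betw[OF bij_betw_velocity, of "\<lambda>x. poly (jacobi_poly alpha j) x * poly (jacobi_poly alpha l) x / kernel_diag alpha (2 * N) x"]
    unfolding legendre_roots .
  finally show ?thesis using jacobi_poly_dual_orthogonal[OF alpha_all_pos assms] by simp
qed

text \<open>Discrete orthonormality exhibits the inverse of \<open>S_mat N\<close> as its transpose
  with each row divided by \<open>kernel_at\<close>.\<close>

lemma node_dist_eq:
  assumes "N \<ge> 1" "G 0 \<in> carrier_vec (2 * N)" "k \<in> {1..2 * N}"
  shows "node_dist N G k = (\<Sum>j<2 * N. poly (legendre j) (velocity N k) * G 0 $ j) / kernel_at k"
proof -
  define B where "B = mat (2 * N) (2 * N) (\<lambda>(i, j). poly (legendre j) (velocity N (i + 1)) / kernel_at (i + 1))"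
  have S: "S_mat N \<in> carrier_mat (2 * N) (2 * N)" and B: "B \<in> carrier_mat (2 * N) (2 * N)"
    by (simp_all add: S_mat_def B_def)
  have SB: "S_mat N * B = 1\<^sub>m (2 * N)"
  proof (rule eq_matI)
    fix j l assume jl: "j < dim_row (1\<^sub>m (2 * N))" "l < dim_col (1\<^sub>m (2 * N))"
    have "(S_mat N * B) $$ (j, l) = (\<Sum>k<2 * N. poly (legendre j) (velocity N (Suc k)) * poly (legendre l) (velocity N (Suc k)) / kernel_at (Suc k))"
      using jl by (simp add: S_mat_def B_def scalar_prod_def lessThan_atLeast0)
    also have "\<dots> = (\<Sum>k=1..2 * N. poly (legendre j) (velocity N k) * poly (legendre l) (velocity N k) / kernel_at k)"
      by (simp add: sum.atLeast1_atMost_eq)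
    also have "\<dots> = (if j = l then 1 else 0)"
      using jl by (intro legendre_dual_orthogonal) auto
    finally show "(S_mat N * B) $$ (j, l) = 1\<^sub>m (2 * N) $$ (j, l)" using jl by simp
  qed (simp_all add: S_mat_def B_def)
  have BS: "B * S_mat N = 1\<^sub>m (2 * N)" by (rule mat_mult_left_right_inverse[OF S B SB])
  \<comment> \<open>Invertibility rules out \<open>None\<close>, so \<open>the\<close> in
    \<open>node_dist\<close> yields the actual inverse.\<close>
  have "S_mat N \<in> Units (ring_mat TYPE(real) (2 * N) ())"
    unfolding Units_def using S B SB BS by (auto simp: ring_mat_simps)
  then obtain B' where B': "mat_inverse (S_mat N) = Some B'"
    using mat_inverse(1)[OF S, where b = "()"] by (cases "mat_inverse (S_mat N)") auto
  then have "B' * S_mat N = 1\<^sub>m (2 * N)" "B' \<in> carrier_mat (2 * N) (2 * N)"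
    using mat_inverse(2)[OF S] by auto
  then have "B' = B" using B S SB by (metis assoc_mult_mat left_mult_one_mat right_mult_one_mat)
  have "node_dist N G k = (B *\<^sub>v G 0) $ (k - 1)"
    by (simp add: node_dist_def B' \<open>B' = B\<close>)
  also have "\<dots> = (\<Sum>j<2 * N. poly (legendre j) (velocity N k) / kernel_at k * G 0 $ j)"
    using assms by (auto simp: B_def scalar_prod_def lessThan_atLeast0)
  finally show ?thesis by (simp add: sum_divide_distrib)
qed

end

section \<open>Bounded solutions\<close>

text \<open>Moments 2, 3, ... are coupled by \<open>alpha 3\<close>, \<open>alpha 4\<close>, ..., so
  the trailing block of \<open>A_mat N\<close> is a Jacobi matrix with coefficients shifted by
  two.\<close>

abbreviation assoc_alpha :: "nat \<Rightarrow> real" where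
  "assoc_alpha \<equiv> \<lambda>k. alpha (k + 2)"

abbreviation assoc_poly :: "nat \<Rightarrow> real \<Rightarrow> real" where
  "assoc_poly k x \<equiv> poly (jacobi_poly assoc_alpha k) x"

text \<open>A mode \<open>exp (- x / \<mu>) \<phi>\<close> solves \<open>A G' = Q G\<close> iff \<open>A \<phi> = - \<mu> Q \<phi>\<close>. The rows from 2 on
  say that \<open>(\<phi>\<^sub>2, \<phi>\<^sub>3, \<dots>)\<close> is an eigenvector of the trailing Jacobi block of \<open>A\<close>, row 0 says
  \<open>\<phi>\<^sub>1 = 0\<close>, and row 1 fixes \<open>\<phi>\<^sub>0\<close>.\<close>

definition eigvec :: "real \<Rightarrow> nat \<Rightarrow> real" where
  "eigvec \<mu> j = (if j = 0 then - alpha 2 / alpha 1 else if j = 1 then 0 else assoc_poly (j - 2) \<mu>)"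

text \<open>A factor \<open>exp (- x / \<mu>)\<close> stays bounded on the half line only for
  positive \<mu>.\<close>

definition decay_roots :: "nat \<Rightarrow> real set" where
  "decay_roots N = {x. x > 0 \<and> assoc_poly (2 * N - 2) x = 0}"

definition mode_root :: "nat \<Rightarrow> nat \<Rightarrow> real" where
  "mode_root N l = sorted_list_of_set (decay_roots N) ! l"

text \<open>Indices 0 and 1 are the constant modes, indices \<open>2..N\<close> the decaying ones.
  Coefficients 0 and 1 of a \<open>mode_sum\<close> are thus the limits of its moments 0 and
  1.\<close>

fun mode :: "nat \<Rightarrow> nat \<Rightarrow> nat \<Rightarrow> real" where
  "mode N 0 j = of_bool (j = 0)"
| "mode N (Suc 0) j = of_bool (j = 1)"
| "mode N (Suc (Suc l)) j = eigvec (mode_root N l) j"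

fun rate :: "nat \<Rightarrow> nat \<Rightarrow> real" where
  "rate N 0 = 0"
| "rate N (Suc 0) = 0"
| "rate N (Suc (Suc l)) = 1 / mode_root N l"

definition mode_sum :: "nat \<Rightarrow> (nat \<Rightarrow> real) \<Rightarrow> real \<Rightarrow> real vec" where
  "mode_sum N c x = vec (2 * N) (\<lambda>j. \<Sum>i\<le>N. c i * exp (- (rate N i * x)) * mode N i j)"

definition A_op :: "nat \<Rightarrow> (nat \<Rightarrow> real) \<Rightarrow> nat \<Rightarrow> real" where
  "A_op N g j = (\<Sum>l<2 * N. A_mat N $$ (j, l) * g l)"

lemma assoc_alpha_pos: "\<forall>k\<ge>1. assoc_alpha k > 0"
  using alpha_pos by simp

lemma A_mat_mult:
  assumes "g \<in> carrier_vec (2 * N)" "j < 2 * N"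
  shows "(A_mat N *\<^sub>v g) $ j = A_op N (\<lambda>l. g $ l) j"
  using assms by (simp add: A_op_def A_mat_def scalar_prod_def lessThan_atLeast0)

lemma Q_mat_mult:
  assumes "g \<in> carrier_vec (2 * N)" "j < 2 * N"
  shows "(Q_mat N *\<^sub>v g) $ j = (if j \<ge> 2 then - g $ j else 0)"
proof -
  have "(Q_mat N *\<^sub>v g) $ j = (\<Sum>l<2 * N. (if j = l \<and> 2 \<le> j then - 1 else 0) * g $ l)"
    using assms by (simp add: Q_mat_def scalar_prod_def lessThan_atLeast0)
  also have "\<dots> = (\<Sum>l<2 * N. if l = j then (if 2 \<le> j then - g $ j else 0) else 0)"
    by (intro sum.cong) auto
  finally show ?thesis using assms by simp
qed

lemma A_op_eq:
  assumes "j < 2 * N"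
  shows "A_op N g j = (if j \<ge> 1 then alpha j * g (j - 1) else 0) + (if j + 1 < 2 * N then alpha (j + 1) * g (j + 1) else 0)"
proof -
  have "A_op N g j = (\<Sum>l<2 * N. (if l + 1 = j then alpha j * g l else 0) + (if l = j + 1 then alpha (j + 1) * g l else 0))"
    unfolding A_op_def by (intro sum.cong) (use assms in \<open>auto simp: A_mat_def\<close>)
  also have "\<dots> = (\<Sum>l<2 * N. if l + 1 = j then alpha j * g l else 0) + (\<Sum>l<2 * N. if l = j + 1 then alpha (j + 1) * g l else 0)"
    by (rule sum.distrib)
  also have "(\<Sum>l<2 * N. if l + 1 = j then alpha j * g l else 0) = (if j \<ge> 1 then alpha j * g (j - 1) else 0)"
  proof (cases j)
    case (Suc i)
    then show ?thesis using assms by simp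
  qed simp
  finally show ?thesis by simp
qed

lemma A_op_symmetric:
  "(\<Sum>j<2 * N. u j * A_op N v j) = (\<Sum>j<2 * N. A_op N u j * v j)"
proof -
  have "(\<Sum>j<2 * N. u j * A_op N v j) = (\<Sum>j<2 * N. \<Sum>l<2 * N. A_mat N $$ (j, l) * u j * v l)"
    by (simp add: A_op_def sum_distrib_left mult_ac)
  also have "\<dots> = (\<Sum>l<2 * N. \<Sum>j<2 * N. A_mat N $$ (j, l) * u j * v l)"
    by (rule sum.swap)
  also have "\<dots> = (\<Sum>l<2 * N. \<Sum>j<2 * N. A_mat N $$ (l, j) * u j * v l)"
    by (intro sum.cong) (auto simp: A_mat_def)
  finally show ?thesis by (simp add: A_op_def sum_distrib_right)
qed

lemma A_op_sum: "A_op N (\<lambda>j. \<Sum>i\<in>I. h i * f i j) j = (\<Sum>i\<in>I. h i * A_op N (f i) j)"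
  unfolding A_op_def by (simp add: sum_distrib_left sum.swap[of _ I] mult_ac)

lemma A_op_eigvec:
  assumes "assoc_poly (2 * N - 2) \<mu> = 0" "j < 2 * N"
  shows "A_op N (eigvec \<mu>) j = (if j \<ge> 2 then \<mu> * eigvec \<mu> j else 0)"
proof -
  have N: "N \<ge> 2"
  proof (rule ccontr)
    assume "\<not> N \<ge> 2"
    then have "2 * N - 2 = 0" by simp
    then show False using assms(1) by simp
  qed
  have nz: "alpha 1 \<noteq> 0" using alpha_pos[of 1] by simp
  note nz' = coeffs_neq_0[OF assoc_alpha_pos]
  consider "j = 0" | "j = 1" | "j = 2" | k where "j = k + 3"
    by (metis One_nat_def Suc_1 add.commute add_2_eq_Suc' less_2_cases not_less_eq not_less_iff_gr_or_eq numeral_3_eq_3 add_Suc_right le_Suc_ex not_less)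
  then show ?thesis
  proof cases
    case 4
    \<comment> \<open>The last row lacks the entry beyond the block, but there the next polynomial
      is the one of degree \<open>2 * N - 2\<close>, which vanishes at \<mu>. So one recurrence
      serves all rows.\<close>
    have "alpha (k + 4) * (if k + 4 < 2 * N then assoc_poly (k + 2) \<mu> else 0) = alpha (k + 4) * assoc_poly (Suc (Suc k)) \<mu>"
    proof (cases "k + 4 < 2 * N")
      case False
      then have "Suc (Suc k) = 2 * N - 2" using assms(2) 4 by simp
      then show ?thesis using assms(1) False by (simp del: jacobi_poly.simps)
    qed simp
    also have "\<dots> = \<mu> * assoc_poly (Suc k) \<mu> - alpha (k + 3) * assoc_poly k \<mu>"
      using jacobi_poly_rec[OF nz', of k \<mu>] by (simp add: eval_nat_numeral del: jacobi_poly.simps)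
    finally show ?thesis
      using assms(2) 4
      by (cases "k + 4 < 2 * N") (simp_all add: A_op_eq eigvec_def eval_nat_numeral del: jacobi_poly.simps)
  next
    case 3
    then show ?thesis using N nz jacobi_poly_Suc0[OF nz', of \<mu>]
      by (simp add: A_op_eq eigvec_def eval_nat_numeral del: jacobi_poly.simps(2))
  qed (use N nz in \<open>simp_all add: A_op_eq eigvec_def eval_nat_numeral\<close>)
qed

section \<open>Spectrum of the trailing block and the modes\<close>

lemma finite_assoc_roots: "finite {x. assoc_poly k x = 0}"
proof (cases "k = 0")
  case False
  then show ?thesis using card_jacobi_poly_roots[OF assoc_alpha_pos, of k] by (metis card.infinite)
qed simp

lemma assoc_root_neq_0: "assoc_poly (2 * N - 2) x = 0 \<Longrightarrow> x \<noteq> 0"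
  using poly_jacobi_poly_even_0[OF coeffs_neq_0[OF assoc_alpha_pos], of "N - 1"]
  by (auto simp: diff_mult_distrib2)

text \<open>By parity the \<open>2 * N - 2\<close> roots, none of them 0, come in pairs of opposite
  sign.\<close>

lemma card_decay_roots: "card (decay_roots N) = N - 1"
proof -
  let ?R = "{x. assoc_poly (2 * N - 2) x = 0}"
  have "?R = decay_roots N \<union> uminus ` decay_roots N"
  proof (intro equalityI subsetI)
    fix x assume x: "x \<in> ?R"
    then have "x \<noteq> 0" using assoc_root_neq_0 by blast
    moreover have "assoc_poly (2 * N - 2) (- x) = 0" using x by (simp add: poly_jacobi_poly_minus)
    ultimately have "x \<in> decay_roots N \<or> - x \<in> decay_roots N"
      using x by (auto simp: decay_roots_def)
    then show "x \<in> decay_roots N \<union> uminus ` decay_roots N" by force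
  qed (auto simp: decay_roots_def poly_jacobi_poly_minus)
  moreover have "finite (decay_roots N)"
    by (rule finite_subset[OF _ finite_assoc_roots[of "2 * N - 2"]]) (auto simp: decay_roots_def)
  moreover have "decay_roots N \<inter> uminus ` decay_roots N = {}"
    by (auto simp: decay_roots_def)
  ultimately have "card ?R = card (decay_roots N) + card (uminus ` decay_roots N)"
    by (metis card_Un_disjoint finite_imageI)
  then show ?thesis
    using card_jacobi_poly_roots[OF assoc_alpha_pos, of "2 * N - 2"] by (simp add: card_image)
qed

lemma bij_betw_mode_root: "bij_betw (mode_root N) {..<N - 1} (decay_roots N)"
proof -
  have "finite (decay_roots N)"
    by (rule finite_subset[OF _ finite_assoc_roots[of "2 * N - 2"]]) (auto simp: decay_roots_def)
  then have "bij_betw ((!) (sorted_list_of_set (decay_roots N))) {..<N - 1} (decay_roots N)"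
    by (intro bij_betw_nth) (simp_all add: card_decay_roots)
  then show ?thesis by (simp add: mode_root_def[abs_def])
qed

lemma mode_root:
  assumes "l < N - 1"
  shows "mode_root N l > 0" "assoc_poly (2 * N - 2) (mode_root N l) = 0"
  using bij_betw_apply[OF bij_betw_mode_root, of l N] assms by (auto simp: decay_roots_def)

lemma sum_modes:
  fixes f :: "nat \<Rightarrow> real"
  assumes "N \<ge> 1"
  shows "(\<Sum>i\<le>N. f i) = f 0 + f 1 + (\<Sum>l<N - 1. f (Suc (Suc l)))"
proof -
  obtain n where "N = Suc n" using assms by (cases N) auto
  then have "(\<Sum>i\<le>N. f i) = f 0 + (\<Sum>i<Suc n. f (Suc i))"
    by (simp only: sum.atMost_Suc_shift lessThan_Suc_atMost)
  also have "(\<Sum>i<Suc n. f (Suc i)) = f 1 + (\<Sum>l<n. f (Suc (Suc l)))"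
    unfolding sum.lessThan_Suc_shift by simp
  finally show ?thesis using \<open>N = Suc n\<close> by simp
qed

lemma mode_cases:
  assumes "i \<le> N"
  obtains "i = 0" | "i = 1" | l where "i = Suc (Suc l)" "l < N - 1"
proof -
  consider "i = 0" | "i = 1" | l where "i = Suc (Suc l)"
    by (metis One_nat_def not0_implies_Suc)
  then show ?thesis using that assms by cases auto
qed

text \<open>The eigenvalue equation in terms of the rate, a form that also covers the constant modes
  and matches termwise differentiation.\<close>

lemma A_op_mode:
  assumes "i \<le> N" "j < 2 * N"
  shows "rate N i * A_op N (mode N i) j = (if j \<ge> 2 then mode N i j else 0)"
  using assms(1)
proof (cases rule: mode_cases)
  case (3 l)
  then have "mode N i = eigvec (mode_root N l)" by auto
  then show ?thesis
    using 3 mode_root[OF 3(2)] A_op_eigvec[OF mode_root(2)[OF 3(2)] assms(2)] by simp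
qed auto

lemma rate_pos: "i \<le> N \<Longrightarrow> 2 \<le> i \<Longrightarrow> rate N i > 0"
  by (erule mode_cases) (auto simp: mode_root)

lemma rate_nonneg: "i \<le> N \<Longrightarrow> rate N i \<ge> 0"
  by (erule mode_cases) (auto simp: mode_root less_imp_le)

text \<open>The integrating factor \<open>exp (k * x)\<close> makes the solution constant. The sign
  of \<open>k\<close> is free: \<open>k = 0\<close> yields conserved quantities, negative
  \<open>k\<close> growing modes.\<close>

lemma decay_solution_unique:
  fixes y :: "real \<Rightarrow> real"
  assumes "\<And>x. x \<ge> 0 \<Longrightarrow> (y has_real_derivative - k * y x) (at x within {0..})" "x \<ge> 0"
  shows "y x = y 0 * exp (- (k * x))"
proof (cases "x = 0")
  case False
  define z where "z = (\<lambda>x. y x * exp (k * x))"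
  have der: "(z has_real_derivative 0) (at t within {0..})" if "t \<ge> 0" for t
    unfolding z_def by (rule derivative_eq_intros assms(1) that refl | simp)+
  have "z x = z 0"
  proof (rule DERIV_isconst_end[of 0 x z])
    show "continuous_on {0..x} z"
      by (rule continuous_on_subset[of "{0..}"])
         (auto simp: continuous_on_eq_continuous_within intro: DERIV_continuous der)
  next
    fix t assume "0 < t" "t < x"
    then have "(z has_real_derivative 0) (at t within {0<..})"
      using der[of t] by (auto intro: DERIV_subset)
    then show "(z has_real_derivative 0) (at t)"
      using \<open>0 < t\<close> by (simp add: at_within_open[of t "{0<..}"])
  qed (use False assms in auto)
  then show ?thesis by (simp add: z_def exp_minus field_simps)
qed simp

lemma bounded_growth_zero:
  fixes y0 :: real
  assumes "\<And>x. x \<ge> 0 \<Longrightarrow> \<bar>y0 * exp (k * x)\<bar> \<le> B" "k > 0"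
  shows "y0 = 0"
proof (rule ccontr)
  assume y0: "y0 \<noteq> 0"
  have "B \<ge> 0" using assms(1)[of 0] by simp
  \<comment> \<open>At \<open>x = B / (\<bar>y0\<bar> * k)\<close> the estimate
    \<open>1 + t \<le> exp t\<close> already forces a modulus of at least
    \<open>\<bar>y0\<bar> + B\<close>.\<close>
  have "\<bar>y0\<bar> * (1 + B / \<bar>y0\<bar>) = \<bar>y0\<bar> + B" using y0 by (simp add: distrib_left)
  then have "B < \<bar>y0\<bar> * (1 + B / \<bar>y0\<bar>)" using y0 by linarith
  also have "\<dots> \<le> \<bar>y0\<bar> * exp (B / \<bar>y0\<bar>)"
    by (intro mult_left_mono exp_ge_add_one_self) auto
  also have "\<dots> = \<bar>y0 * exp (k * (B / (\<bar>y0\<bar> * k)))\<bar>"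
    using assms(2) by (simp add: abs_mult)
  also have "\<dots> \<le> B" using \<open>B \<ge> 0\<close> assms(2) by (intro assms(1)) auto
  finally show False by simp
qed

section \<open>Bounded solutions are sums of modes\<close>

lemma mode_sum_carrier [simp]: "mode_sum N c x \<in> carrier_vec (2 * N)"
  by (simp add: mode_sum_def)

lemma bounded_solution_mode_sum:
  assumes G: "\<And>x. x \<ge> 0 \<Longrightarrow> G x = mode_sum N c x"
  shows "bounded_solution N G"
proof -
  define G' where "G' = (\<lambda>x. vec (2 * N) (\<lambda>j. \<Sum>i\<le>N. - (c i * rate N i * exp (- (rate N i * x))) * mode N i j))"
  have Gj: "G x $ j = (\<Sum>i\<le>N. c i * exp (- (rate N i * x)) * mode N i j)" if "x \<ge> 0" "j < 2 * N" for x j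
    using that by (simp add: G mode_sum_def)
  have bounded: "\<bar>G x $ j\<bar> \<le> (\<Sum>j<2 * N. \<Sum>i\<le>N. \<bar>c i * mode N i j\<bar>)" if xj: "x \<ge> 0" "j < 2 * N" for x j
  proof -
    have "\<bar>c i * exp (- (rate N i * x)) * mode N i j\<bar> \<le> \<bar>c i * mode N i j\<bar>" if "i \<le> N" for i
    proof -
      have "\<bar>c i * exp (- (rate N i * x)) * mode N i j\<bar> = exp (- (rate N i * x)) * \<bar>c i * mode N i j\<bar>"
        by (simp add: abs_mult)
      also have "\<dots> \<le> 1 * \<bar>c i * mode N i j\<bar>"
        by (intro mult_right_mono) (use rate_nonneg[OF that] xj in auto)
      finally show ?thesis by simp
    qed
    then have "\<bar>G x $ j\<bar> \<le> (\<Sum>i\<le>N. \<bar>c i * mode N i j\<bar>)"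
      unfolding Gj[OF xj] by (intro order.trans[OF sum_abs] sum_mono) auto
    also have "\<dots> \<le> (\<Sum>j<2 * N. \<Sum>i\<le>N. \<bar>c i * mode N i j\<bar>)"
      using xj by (intro member_le_sum[of j "{..<2 * N}" "\<lambda>j. \<Sum>i\<le>N. \<bar>c i * mode N i j\<bar>"]) (auto intro: sum_nonneg)
    finally show ?thesis .
  qed
  have deriv: "has_halfline_deriv (2 * N) G G'"
    unfolding has_halfline_deriv_def
  proof (intro conjI allI impI)
    fix j :: nat and x :: real assume jx: "j < 2 * N" "0 \<le> x"
    have "((\<lambda>y. \<Sum>i\<le>N. c i * exp (- (rate N i * y)) * mode N i j) has_real_derivative G' x $ j) (at x within {0..})"
      unfolding G'_def using jx by (auto intro!: derivative_eq_intros sum.cong)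
    then show "((\<lambda>y. G y $ j) has_real_derivative G' x $ j) (at x within {0..})"
      by (rule has_field_derivative_transform_within[of _ _ _ _ 1]) (use jx in \<open>auto simp: Gj\<close>)
  qed (simp add: G'_def)
  have cont: "continuous_on {0..} (\<lambda>x. G' x $ j)" if "j < 2 * N" for j
    using that by (auto simp: G'_def intro!: continuous_intros)
  have ode: "A_mat N *\<^sub>v G' x = Q_mat N *\<^sub>v G x" if "x \<ge> 0" for x
  proof (rule eq_vecI)
    fix j assume "j < dim_vec (Q_mat N *\<^sub>v G x)"
    then have j: "j < 2 * N" by (simp add: Q_mat_def)
    have "(A_mat N *\<^sub>v G' x) $ j = A_op N (\<lambda>l. \<Sum>i\<le>N. - (c i * rate N i * exp (- (rate N i * x))) * mode N i l) j"
      using j by (subst A_mat_mult) (auto simp: G'_def A_op_def intro!: sum.cong)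
    also have "\<dots> = (\<Sum>i\<le>N. - (c i * exp (- (rate N i * x))) * (rate N i * A_op N (mode N i) j))"
      unfolding A_op_sum by (simp add: mult_ac)
    also have "\<dots> = (\<Sum>i\<le>N. - (c i * exp (- (rate N i * x))) * (if j \<ge> 2 then mode N i j else 0))"
      by (intro sum.cong refl arg_cong2[of _ _ _ _ "(*)"] A_op_mode) (use j in auto)
    also have "\<dots> = (if j \<ge> 2 then - G x $ j else 0)"
      using that j by (simp add: Gj sum_negf)
    also have "\<dots> = (Q_mat N *\<^sub>v G x) $ j"
      using that j by (subst Q_mat_mult) (auto simp: G)
    finally show "(A_mat N *\<^sub>v G' x) $ j = (Q_mat N *\<^sub>v G x) $ j" .
  qed (simp add: A_mat_def Q_mat_def)
  show ?thesis
    unfolding bounded_solution_def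
    by (intro conjI exI[of _ "\<Sum>j<2 * N. \<Sum>i\<le>N. \<bar>c i * mode N i j\<bar>"] exI[of _ G'] allI impI)
       (use bounded deriv cont ode in \<open>auto simp: G\<close>)
qed

text \<open>Expansion in the orthogonal eigenbasis of the trailing block: pairing with the
  eigenvector, divided by its squared length. Dual orthogonality is the completeness of this
  basis.\<close>

lemma assoc_dual_expansion:
  assumes "2 \<le> j" "j < 2 * N"
  shows "g j = (\<Sum>\<mu> | assoc_poly (2 * N - 2) \<mu> = 0.
     eigvec \<mu> j * (\<Sum>i\<in>{2..<2 * N}. eigvec \<mu> i * g i) / kernel_diag assoc_alpha (2 * N - 2) \<mu>)"
proof -
  let ?R = "{\<mu>. assoc_poly (2 * N - 2) \<mu> = 0}"
  have "(\<Sum>\<mu>\<in>?R. eigvec \<mu> j * (\<Sum>i\<in>{2..<2 * N}. eigvec \<mu> i * g i) / kernel_diag assoc_alpha (2 * N - 2) \<mu>)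
    = (\<Sum>\<mu>\<in>?R. \<Sum>i\<in>{2..<2 * N}. g i * (eigvec \<mu> j * eigvec \<mu> i / kernel_diag assoc_alpha (2 * N - 2) \<mu>))"
    by (intro sum.cong) (simp_all add: sum_distrib_left sum_divide_distrib mult_ac)
  also have "\<dots> = (\<Sum>i\<in>{2..<2 * N}. g i * (\<Sum>\<mu>\<in>?R. eigvec \<mu> j * eigvec \<mu> i / kernel_diag assoc_alpha (2 * N - 2) \<mu>))"
    by (subst sum.swap) (simp add: sum_distrib_left)
  also have "\<dots> = (\<Sum>i\<in>{2..<2 * N}. if i = j then g i else 0)"
  proof (intro sum.cong refl)
    fix i assume i: "i \<in> {2..<2 * N}"
    have "(\<Sum>\<mu>\<in>?R. eigvec \<mu> j * eigvec \<mu> i / kernel_diag assoc_alpha (2 * N - 2) \<mu>)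
      = (\<Sum>\<mu>\<in>?R. assoc_poly (j - 2) \<mu> * assoc_poly (i - 2) \<mu> / kernel_diag assoc_alpha (2 * N - 2) \<mu>)"
      using i assms by (simp add: eigvec_def)
    also have "\<dots> = (if j - 2 = i - 2 then 1 else 0)"
      using i assms by (intro jacobi_poly_dual_orthogonal assoc_alpha_pos) auto
    also have "\<dots> = (if i = j then 1 else 0)" using i assms by auto
    finally show "g i * (\<Sum>\<mu>\<in>?R. eigvec \<mu> j * eigvec \<mu> i / kernel_diag assoc_alpha (2 * N - 2) \<mu>) = (if i = j then g i else 0)"
      by simp
  qed
  finally show ?thesis using assms by simp
qed

lemma sum_from_2: "(\<Sum>j<n. if 2 \<le> j then f j else 0) = (\<Sum>j\<in>{2..<n}. f j :: real)" for n :: nat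
  by (rule sum.mono_neutral_cong_right) auto

text \<open>Projecting on the eigenvectors of the trailing block decouples the system into scalar
  equations, and boundedness removes those with negative eigenvalue. Two conserved quantities
  account for the constant modes.\<close>

lemma bounded_solution_imp_mode_sum:
  assumes N: "N \<ge> 1" and "bounded_solution N G"
  obtains c where "\<And>x. x \<ge> 0 \<Longrightarrow> G x = mode_sum N c x"
proof -
  from assms(2) obtain B G' where *: "\<forall>x\<ge>0. G x \<in> carrier_vec (2 * N)"
    "\<forall>x\<ge>0. \<forall>j<2 * N. \<bar>G x $ j\<bar> \<le> B" "has_halfline_deriv (2 * N) G G'"
    "\<forall>x\<ge>0. A_mat N *\<^sub>v G' x = Q_mat N *\<^sub>v G x"
    unfolding bounded_solution_def by blast
  note carr = *(1)[rule_format] and B = *(2)[rule_format] and ode = *(4)[rule_format]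
  have carr': "\<And>x. x \<ge> 0 \<Longrightarrow> G' x \<in> carrier_vec (2 * N)"
    and der: "\<And>x j. x \<ge> 0 \<Longrightarrow> j < 2 * N \<Longrightarrow> ((\<lambda>y. G y $ j) has_real_derivative G' x $ j) (at x within {0..})"
    using *(3) by (simp_all add: has_halfline_deriv_def)
  have row: "A_op N (\<lambda>l. G' x $ l) j = (if j \<ge> 2 then - G x $ j else 0)" if "x \<ge> 0" "j < 2 * N" for x j
    using ode[OF that(1)] A_mat_mult[OF carr' that(2)] Q_mat_mult[OF carr that(2)] that by metis
  define y where "y = (\<lambda>\<mu> x. \<Sum>i\<in>{2..<2 * N}. eigvec \<mu> i * G x $ i)"
  have y_der: "(y \<mu> has_real_derivative - (1 / \<mu>) * y \<mu> x) (at x within {0..})"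
    if \<mu>: "assoc_poly (2 * N - 2) \<mu> = 0" and x: "x \<ge> 0" for \<mu> x
  proof -
    \<comment> \<open>Symmetry moves \<open>A\<close> onto the eigenvector, whose image has zero
      entries 0 and 1, so only derivatives of the moments from 2 on remain.\<close>
    have "\<mu> * (\<Sum>i\<in>{2..<2 * N}. eigvec \<mu> i * G' x $ i) = (\<Sum>j<2 * N. A_op N (eigvec \<mu>) j * G' x $ j)"
      unfolding sum_distrib_left sum_from_2[symmetric]
      by (intro sum.cong refl) (simp add: A_op_eigvec[OF \<mu>])
    also have "\<dots> = (\<Sum>j<2 * N. eigvec \<mu> j * (if j \<ge> 2 then - G x $ j else 0))"
      unfolding A_op_symmetric[symmetric] using x by (simp add: row)
    also have "\<dots> = - y \<mu> x"
      unfolding y_def sum_from_2[symmetric] sum_negf[symmetric] by (intro sum.cong) auto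
    finally have "(\<Sum>i\<in>{2..<2 * N}. eigvec \<mu> i * G' x $ i) = - (1 / \<mu>) * y \<mu> x"
      using assoc_root_neq_0[OF \<mu>] by (simp add: field_simps)
    moreover have "(y \<mu> has_real_derivative (\<Sum>i\<in>{2..<2 * N}. eigvec \<mu> i * G' x $ i)) (at x within {0..})"
      unfolding y_def by (intro DERIV_sum DERIV_cmult der x) auto
    ultimately show ?thesis by simp
  qed
  have y: "y \<mu> x = y \<mu> 0 * exp (- (1 / \<mu> * x))" if "assoc_poly (2 * N - 2) \<mu> = 0" "x \<ge> 0" for \<mu> x
    using y_der that by (intro decay_solution_unique) auto
  have y_neg: "y \<mu> x = 0" if \<mu>: "assoc_poly (2 * N - 2) \<mu> = 0" "\<mu> \<notin> decay_roots N" and x: "x \<ge> 0" for \<mu> x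
  proof -
    have "\<mu> < 0" using \<mu> assoc_root_neq_0[OF \<mu>(1)] by (force simp: decay_roots_def)
    moreover have "\<bar>y \<mu> 0 * exp ((- (1 / \<mu>)) * t)\<bar> \<le> (\<Sum>i\<in>{2..<2 * N}. \<bar>eigvec \<mu> i\<bar> * B)" if "t \<ge> 0" for t
    proof -
      have "\<bar>y \<mu> t\<bar> \<le> (\<Sum>i\<in>{2..<2 * N}. \<bar>eigvec \<mu> i\<bar> * B)"
        unfolding y_def using that
        by (intro order.trans[OF sum_abs] sum_mono) (auto simp: abs_mult intro!: mult_left_mono B)
      then show ?thesis using y[OF \<mu>(1) that] by simp
    qed
    ultimately have "y \<mu> 0 = 0"
      by (intro bounded_growth_zero[of "y \<mu> 0" "- (1 / \<mu>)"]) auto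
    then show ?thesis using y[OF \<mu>(1) x] by simp
  qed
  define H where "H = kernel_diag assoc_alpha (2 * N - 2)"
  \<comment> \<open>Row 1 of the equation says that this combination of moments 0 and 2 is constant;
    for \<open>N = 1\<close> there is no moment 2.\<close>
  define z where "z = (\<lambda>x. G x $ 0 + alpha 2 / alpha 1 * (if N \<ge> 2 then G x $ 2 else 0))"
  define c where "c = (\<lambda>i. if i = 0 then z 0 else if i = 1 then G 0 $ 1
    else y (mode_root N (i - 2)) 0 / H (mode_root N (i - 2)))"
  have modes: "G x $ j = (\<Sum>l<N - 1. c (Suc (Suc l)) * exp (- (rate N (Suc (Suc l)) * x)) * mode N (Suc (Suc l)) j)"
    if j: "2 \<le> j" "j < 2 * N" and x: "x \<ge> 0" for j x
  proof -
    have "G x $ j = (\<Sum>\<mu> | assoc_poly (2 * N - 2) \<mu> = 0. eigvec \<mu> j * y \<mu> x / H \<mu>)"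
      unfolding y_def H_def by (rule assoc_dual_expansion[OF j])
    also have "\<dots> = (\<Sum>\<mu>\<in>decay_roots N. eigvec \<mu> j * y \<mu> x / H \<mu>)"
      by (rule sum.mono_neutral_right) (use finite_assoc_roots y_neg x in \<open>auto simp: decay_roots_def\<close>)
    also have "\<dots> = (\<Sum>l<N - 1. eigvec (mode_root N l) j * y (mode_root N l) x / H (mode_root N l))"
      by (rule sum.reindex_bij_betw[OF bij_betw_mode_root, symmetric])
    also have "\<dots> = (\<Sum>l<N - 1. c (Suc (Suc l)) * exp (- (rate N (Suc (Suc l)) * x)) * mode N (Suc (Suc l)) j)"
      using y[OF mode_root(2) x] by (intro sum.cong refl) (simp add: c_def)
    finally show ?thesis .
  qed
  have nz: "alpha 1 \<noteq> 0" using alpha_pos[of 1] by simp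
  have "((\<lambda>x. G x $ 1) has_real_derivative - 0 * G x $ 1) (at x within {0..})" if "x \<ge> 0" for x
    using der[OF that, of 1] row[OF that, of 0] N nz by (simp add: A_op_eq)
  then have g1: "G x $ 1 = G 0 $ 1" if "x \<ge> 0" for x
    using decay_solution_unique[of "\<lambda>x. G x $ 1" 0 x] that by simp
  have "(z has_real_derivative - 0 * z x) (at x within {0..})" if x: "x \<ge> 0" for x
  proof (cases "N \<ge> 2")
    case True
    have "(z has_real_derivative G' x $ 0 + alpha 2 / alpha 1 * G' x $ 2) (at x within {0..})"
      using DERIV_add[OF der[OF x, of 0] DERIV_cmult[OF der[OF x, of 2], of "alpha 2 / alpha 1"]] True
      by (simp add: z_def)
    moreover have "G' x $ 0 + alpha 2 / alpha 1 * G' x $ 2 = 0"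
      using row[OF x, of 1] True nz by (simp add: A_op_eq field_simps eval_nat_numeral)
    ultimately show ?thesis by simp
  next
    case False
    then show ?thesis
      using der[OF x, of 0] row[OF x, of 1] N nz by (simp add: z_def A_op_eq)
  qed
  then have z: "z x = z 0" if "x \<ge> 0" for x
    using decay_solution_unique[of z 0 x] that by simp
  show ?thesis
  proof (rule that[of c], rule eq_vecI)
    fix x :: real and j assume x: "x \<ge> 0" and "j < dim_vec (mode_sum N c x)"
    then have j: "j < 2 * N" by (simp add: mode_sum_def)
    have *: "mode_sum N c x $ j = c 0 * of_bool (j = 0) + c 1 * of_bool (j = 1)
        + (\<Sum>l<N - 1. c (Suc (Suc l)) * exp (- (rate N (Suc (Suc l)) * x)) * mode N (Suc (Suc l)) j)"
      using j by (simp add: mode_sum_def sum_modes[OF N])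
    consider "j = 0" | "j = 1" | "j \<ge> 2" by linarith
    then show "G x $ j = mode_sum N c x $ j"
    proof cases
      case 1
      \<comment> \<open>Entry 2 of every \<open>eigvec\<close> is 1 and entry 0 is
        \<open>- alpha 2 / alpha 1\<close>, so the entries 0 add up to a multiple of moment
        2.\<close>
      have "(\<Sum>l<N - 1. c (Suc (Suc l)) * exp (- (rate N (Suc (Suc l)) * x)) * mode N (Suc (Suc l)) 0)
        = - (alpha 2 / alpha 1) * (if N \<ge> 2 then G x $ 2 else 0)"
      proof (cases "N \<ge> 2")
        case True
        then show ?thesis
          using modes[of 2 x] x by (simp add: eigvec_def sum_distrib_left mult_ac)
      qed simp
      then show ?thesis using * z[OF x] 1 by (simp add: c_def z_def)
    next
      case 2
      then show ?thesis using * g1[OF x] by (simp add: eigvec_def c_def)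
    next
      case 3
      then show ?thesis using * modes[OF 3 j x] by simp
    qed
  qed (use carr in \<open>auto simp: mode_sum_def\<close>)
qed

lemma tendsto_exp_decay:
  fixes k :: real
  assumes "k > 0"
  shows "((\<lambda>x. exp (- (k * x))) \<longlongrightarrow> 0) at_top"
  by (intro filterlim_compose[OF exp_at_bot] filterlim_compose[OF filterlim_uminus_at_bot_at_top]
      filterlim_tendsto_pos_mult_at_top[OF tendsto_const assms filterlim_ident])

text \<open>The decaying terms vanish at infinity, so the limits exist and the total function
  \<open>Lim\<close> returns true limits here.\<close>

lemma Lim_mode_sum:
  assumes G: "\<And>x. x \<ge> 0 \<Longrightarrow> G x = mode_sum N c x" and "N \<ge> 1" "j < 2"
  shows "Lim at_top (\<lambda>x. G x $ j) = c j"
proof -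
  have "((\<lambda>x. \<Sum>i\<le>N. c i * exp (- (rate N i * x)) * mode N i j) \<longlongrightarrow> (\<Sum>i\<le>N. c i * of_bool (i < 2) * mode N i j)) at_top"
  proof (intro tendsto_sum tendsto_mult tendsto_const)
    fix i assume "i \<in> {..N}"
    then have "i \<le> N" by simp
    then show "((\<lambda>x. exp (- (rate N i * x))) \<longlongrightarrow> of_bool (i < 2)) at_top"
      using tendsto_exp_decay[OF rate_pos, of i N] by (cases rule: mode_cases) auto
  qed
  also have "(\<Sum>i\<le>N. c i * of_bool (i < 2) * mode N i j) = c j"
    using assms by (auto simp: sum_modes less_2_cases_iff)
  finally have "((\<lambda>x. G x $ j) \<longlongrightarrow> c j) at_top"
    by (rule Lim_transform_eventually)
       (use assms in \<open>auto simp: mode_sum_def eventually_at_top_linorder intro!: exI[of _ 0]\<close>)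
  then show ?thesis by (intro tendsto_Lim) auto
qed

section \<open>The half-space problem with a reflection condition\<close>

text \<open>Component \<open>k\<close> of the inverse of \<open>S_mat N\<close> applied to mode
  \<open>i\<close>; at \<open>x = 0\<close> all exponentials are 1, so node values depend on the
  coefficients alone.\<close>

definition mode_dist :: "nat \<Rightarrow> nat \<Rightarrow> nat \<Rightarrow> real" where
  "mode_dist N i k = (\<Sum>j<2 * N. poly (legendre j) (velocity N k) * mode N i j) / kernel_at N k"

definition coeff_dist :: "nat \<Rightarrow> (nat \<Rightarrow> real) \<Rightarrow> nat \<Rightarrow> real" where
  "coeff_dist N c k = (\<Sum>i\<le>N. c i * mode_dist N i k)"

lemma coeff_dist_add: "coeff_dist N (\<lambda>i. c i + d i) k = coeff_dist N c k + coeff_dist N d k"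
  by (simp add: coeff_dist_def algebra_simps sum.distrib)

lemma coeff_dist_diff: "coeff_dist N (\<lambda>i. c i - d i) k = coeff_dist N c k - coeff_dist N d k"
  by (simp add: coeff_dist_def algebra_simps sum_subtractf)

lemma coeff_dist_divide: "coeff_dist N (\<lambda>i. c i / t) k = coeff_dist N c k / t"
  by (simp add: coeff_dist_def sum_divide_distrib)

lemma coeff_dist_sum: "coeff_dist N (\<lambda>i. \<Sum>l\<in>L. c l i) k = (\<Sum>l\<in>L. coeff_dist N (c l) k)"
  unfolding coeff_dist_def by (subst sum.swap) (simp add: sum_distrib_right)

lemma coeff_dist_eq_0: "(\<And>i. i \<le> N \<Longrightarrow> c i = 0) \<Longrightarrow> coeff_dist N c k = 0"
  by (simp add: coeff_dist_def)

lemma coeff_dist_eq: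
  "coeff_dist N c k = (\<Sum>j<2 * N. poly (legendre j) (velocity N k) * (\<Sum>i\<le>N. c i * mode N i j)) / kernel_at N k"
proof -
  have "(\<Sum>j<2 * N. poly (legendre j) (velocity N k) * (\<Sum>i\<le>N. c i * mode N i j))
    = (\<Sum>i\<le>N. c i * (\<Sum>j<2 * N. poly (legendre j) (velocity N k) * mode N i j))"
    by (simp add: sum_distrib_left sum.swap[of _ "{..N}"] mult_ac)
  then show ?thesis
    by (simp only: coeff_dist_def mode_dist_def sum_divide_distrib[where A = "{..N}"] times_divide_eq_right)
qed

lemma node_dist_mode_sum:
  assumes "G 0 = mode_sum N c 0" "N \<ge> 1" "k \<in> {1..2 * N}"
  shows "node_dist N G k = coeff_dist N c k"
proof -
  have "node_dist N G k = (\<Sum>j<2 * N. poly (legendre j) (velocity N k) * G 0 $ j) / kernel_at N k"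
    by (rule node_dist_eq) (use assms in auto)
  then show ?thesis by (simp add: coeff_dist_eq assms(1) mode_sum_def)
qed

section \<open>The energy form in velocities and in modes\<close>

lemma A_op_legendre:
  assumes "k \<in> {1..2 * N}" "j < 2 * N"
  shows "A_op N (\<lambda>j. poly (legendre j) (velocity N k)) j = velocity N k * poly (legendre j) (velocity N k)"
proof (cases j)
  case 0
  have "alpha (Suc 0) * poly (jacobi_poly alpha (Suc 0)) (velocity N k) = velocity N k"
    by (rule jacobi_poly_Suc0[OF coeffs_neq_0[OF alpha_all_pos]])
  moreover have "1 < 2 * N" using assms(1) by (cases N) auto
  ultimately show ?thesis using 0
    by (simp add: A_op_eq legendre_eq_jacobi_poly del: jacobi_poly.simps(2))
next
  case (Suc i)
  have "velocity N k * poly (legendre j) (velocity N k) = poly ([:0, 1:] * legendre j) (velocity N k)"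
    by simp
  also have "\<dots> = alpha (j + 1) * poly (legendre (j + 1)) (velocity N k) + alpha j * poly (legendre (j - 1)) (velocity N k)"
    using Suc by (subst legendre_recurrence) (simp_all del: legendre.simps)
  \<comment> \<open>The recurrence covers the last row as well, because the polynomial of degree
    \<open>2 * N\<close> vanishes at the velocity. So the columns of \<open>S_mat N\<close> are
    eigenvectors of \<open>A_mat N\<close>.\<close>
  also have "alpha (j + 1) * poly (legendre (j + 1)) (velocity N k) =
      (if j + 1 < 2 * N then alpha (j + 1) * poly (legendre (j + 1)) (velocity N k) else 0)"
  proof (cases "j + 1 < 2 * N")
    case False
    then have "j + 1 = 2 * N" using assms(2) by simp
    then have "poly (legendre (j + 1)) (velocity N k) = 0" using velocity_root[OF assms(1)] by metis
    then show ?thesis using False by (simp del: legendre.simps)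
  qed simp
  finally show ?thesis using Suc assms(2) by (simp add: A_op_eq del: legendre.simps)
qed

lemma sum_velocities_reflect:
  fixes f :: "nat \<Rightarrow> real" and N :: nat
  shows "(\<Sum>k=1..2 * N. f k) = (\<Sum>k=1..N. f k + f (2 * N - k + 1))"
proof -
  have "(\<Sum>k=1..2 * N. f k) = (\<Sum>k=1..N. f k) + (\<Sum>k=N + 1..2 * N. f k)"
    using sum.ub_add_nat[of 1 N f N] by (simp add: mult_2)
  also have "(\<Sum>k=N + 1..2 * N. f k) = (\<Sum>k=1..N. f (2 * N - k + 1))"
    by (rule sum.reindex_bij_witness[of _ "\<lambda>k. 2 * N - k + 1" "\<lambda>k. 2 * N - k + 1"]) auto
  finally show ?thesis by (simp add: sum.distrib)
qed

text \<open>The columns of \<open>S_mat N\<close> are an orthogonal eigenbasis of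
  \<open>A_mat N\<close>. In it \<open>g\<close> has the coefficients \<open>f k\<close>, so the
  form is diagonal, with \<open>kernel_at N k\<close> as squared lengths.\<close>

lemma energy_velocities:
  fixes g :: "nat \<Rightarrow> real"
  assumes N: "N \<ge> 1"
    and f: "\<And>k. f k = (\<Sum>j<2 * N. poly (legendre j) (velocity N k) * g j) / kernel_at N k"
  shows "(\<Sum>j<2 * N. g j * A_op N g j) = (\<Sum>k=1..2 * N. velocity N k * kernel_at N k * (f k)\<^sup>2)"
proof -
  let ?P = "\<lambda>j k. poly (legendre j) (velocity N k)"
  have g: "g j = (\<Sum>k=1..2 * N. f k * ?P j k)" if "j < 2 * N" for j
  proof -
    have "(\<Sum>k=1..2 * N. f k * ?P j k) = (\<Sum>k=1..2 * N. \<Sum>l<2 * N. g l * (?P j k * ?P l k / kernel_at N k))"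
      unfolding f by (simp add: sum_divide_distrib sum_distrib_left sum_distrib_right mult_ac)
    also have "\<dots> = (\<Sum>l<2 * N. g l * (\<Sum>k=1..2 * N. ?P j k * ?P l k / kernel_at N k))"
      by (subst sum.swap) (simp add: sum_distrib_left)
    also have "\<dots> = (\<Sum>l<2 * N. if l = j then g l else 0)"
      by (intro sum.cong refl) (use that in \<open>simp add: legendre_dual_orthogonal del: One_nat_def\<close>)
    finally show ?thesis using that by simp
  qed
  have Ag: "A_op N g j = (\<Sum>k=1..2 * N. f k * (velocity N k * ?P j k))" if "j < 2 * N" for j
  proof -
    have "A_op N g j = A_op N (\<lambda>j. \<Sum>k=1..2 * N. f k * ?P j k) j"
      unfolding A_op_def using g by simp
    also have "\<dots> = (\<Sum>k=1..2 * N. f k * (velocity N k * ?P j k))"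
      unfolding A_op_sum using that by (intro sum.cong refl) (simp add: A_op_legendre)
    finally show ?thesis .
  qed
  have "(\<Sum>j<2 * N. g j * A_op N g j) = (\<Sum>j<2 * N. \<Sum>k=1..2 * N. f k * velocity N k * (?P j k * g j))"
    by (intro sum.cong refl) (simp add: Ag sum_distrib_left mult_ac)
  also have "\<dots> = (\<Sum>k=1..2 * N. f k * velocity N k * (\<Sum>j<2 * N. ?P j k * g j))"
    by (subst sum.swap) (simp add: sum_distrib_left)
  also have "\<dots> = (\<Sum>k=1..2 * N. velocity N k * kernel_at N k * (f k)\<^sup>2)"
    using kernel_at_pos[OF N] unfolding f
    by (intro sum.cong refl) (simp add: power2_eq_square less_imp_neq[symmetric])
  finally show ?thesis .
qed

lemma eigvec_orthogonal:
  assumes "assoc_poly (2 * N - 2) \<mu> = 0" "assoc_poly (2 * N - 2) \<nu> = 0" "\<mu> \<noteq> \<nu>"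
  shows "(\<Sum>j\<in>{2..<2 * N}. eigvec \<mu> j * eigvec \<nu> j) = 0"
proof -
  have "(\<Sum>j\<in>{2..<2 * N}. eigvec \<mu> j * eigvec \<nu> j) = (\<Sum>j<2 * N - 2. assoc_poly j \<mu> * assoc_poly j \<nu>)"
    by (rule sum.reindex_bij_witness[of _ "\<lambda>j. j + 2" "\<lambda>j. j - 2"]) (auto simp: eigvec_def)
  then show ?thesis
    using jacobi_poly_orthogonal[OF coeffs_neq_0[OF assoc_alpha_pos] assms] by simp
qed

definition mode_energy :: "nat \<Rightarrow> nat \<Rightarrow> real" where
  "mode_energy N l = mode_root N l * (\<Sum>j\<in>{2..<2 * N}. (eigvec (mode_root N l) j)\<^sup>2)"

lemma mode_energy_pos:
  assumes "l < N - 1"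
  shows "mode_energy N l > 0"
proof -
  have "(\<Sum>j\<in>{2..<2 * N}. (eigvec (mode_root N l) j)\<^sup>2) > 0"
    by (rule sum_pos2[of _ 2]) (use assms in \<open>auto simp: eigvec_def\<close>)
  then show ?thesis using mode_root(1)[OF assms] by (simp add: mode_energy_def)
qed

text \<open>\<open>A_op\<close> maps a decaying mode to a multiple of its own part from index 2 on.
  The constant modes vanish there, and other decaying modes are orthogonal as eigenvectors of the
  block.\<close>

lemma energy_mode_eigvec:
  assumes "i \<le> N" "l < N - 1"
  shows "(\<Sum>j<2 * N. mode N i j * A_op N (mode N (Suc (Suc l))) j) = (if i = Suc (Suc l) then mode_energy N l else 0)"
proof -
  let ?\<mu> = "mode_root N l"
  have "(\<Sum>j<2 * N. mode N i j * A_op N (mode N (Suc (Suc l))) j)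
    = (\<Sum>j<2 * N. if 2 \<le> j then ?\<mu> * (mode N i j * eigvec ?\<mu> j) else 0)"
  proof (intro sum.cong refl)
    fix j assume "j \<in> {..<2 * N}"
    moreover have "mode N (Suc (Suc l)) = eigvec ?\<mu>" by (rule ext) simp
    ultimately show "mode N i j * A_op N (mode N (Suc (Suc l))) j = (if 2 \<le> j then ?\<mu> * (mode N i j * eigvec ?\<mu> j) else 0)"
      using A_op_eigvec[OF mode_root(2)[OF assms(2)], of j] by simp
  qed
  also have "\<dots> = ?\<mu> * (\<Sum>j\<in>{2..<2 * N}. mode N i j * eigvec ?\<mu> j)"
    unfolding sum_from_2 by (simp add: sum_distrib_left)
  also have "\<dots> = (if i = Suc (Suc l) then mode_energy N l else 0)"
    using assms(1)
  proof (cases rule: mode_cases)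
    case (3 m)
    have "mode_root N m \<noteq> ?\<mu>" if "m \<noteq> l"
      using inj_on_eq_iff[OF bij_betw_imp_inj_on[OF bij_betw_mode_root[of N]], of m l] that 3 assms by simp
    then show ?thesis using 3 mode_root(2) assms eigvec_orthogonal[of N "mode_root N m" ?\<mu>]
      by (auto simp: mode_energy_def power2_eq_square)
  qed auto
  finally show ?thesis .
qed

text \<open>In this form each constant mode pairs to 0 with itself and to \<open>alpha 1\<close>
  with the other one, while a decaying mode pairs nontrivially only with itself.\<close>

lemma energy_modes:
  assumes N: "N \<ge> 1" and g: "g = (\<lambda>j. \<Sum>i\<le>N. c i * mode N i j)"
  shows "(\<Sum>j<2 * N. g j * A_op N g j) = 2 * alpha 1 * c 0 * c 1 + (\<Sum>l<N - 1. (c (Suc (Suc l)))\<^sup>2 * mode_energy N l)"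
proof -
  define E where "E = (\<lambda>i m. \<Sum>j<2 * N. mode N i j * A_op N (mode N m) j)"
  have E_sym: "E i m = E m i" for i m
    using A_op_symmetric[of "mode N i" N "mode N m"] by (simp add: E_def mult.commute)
  have E: "E i (Suc (Suc l)) = (if i = Suc (Suc l) then mode_energy N l else 0)" if "i \<le> N" "l < N - 1" for i l
    unfolding E_def by (rule energy_mode_eigvec[OF that])
  have E': "E (Suc (Suc l)) i = (if i = Suc (Suc l) then mode_energy N l else 0)" if "i \<le> N" "l < N - 1" for i l
    using E[OF that] by (simp add: E_sym)
  have E0: "E 0 m = A_op N (mode N m) 0" for m
    using N by (simp add: E_def of_bool_def if_distrib[of "\<lambda>x. x * _"] cong: if_cong)
  have E1: "E (Suc 0) m = A_op N (mode N m) 1" for m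
    using N by (simp add: E_def of_bool_def if_distrib[of "\<lambda>x. x * _"] cong: if_cong)
  have E01: "E 0 0 = 0" "E 0 (Suc 0) = alpha 1" "E (Suc 0) 0 = alpha 1" "E (Suc 0) (Suc 0) = 0"
    using N by (simp_all add: E0 E1 A_op_eq)
  have "(\<Sum>j<2 * N. g j * A_op N g j) = (\<Sum>j<2 * N. \<Sum>i\<le>N. c i * mode N i j * (\<Sum>m\<le>N. c m * A_op N (mode N m) j))"
    unfolding g A_op_sum by (simp add: sum_distrib_right)
  also have "\<dots> = (\<Sum>i\<le>N. \<Sum>j<2 * N. c i * mode N i j * (\<Sum>m\<le>N. c m * A_op N (mode N m) j))"
    by (rule sum.swap)
  also have "\<dots> = (\<Sum>i\<le>N. c i * (\<Sum>m\<le>N. c m * E i m))"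
    unfolding E_def
    by (intro sum.cong refl) (simp add: sum_distrib_left sum.swap[of _ "{..N}"] mult_ac)
  also have "\<dots> = c 0 * (c 1 * alpha 1) + c 1 * (c 0 * alpha 1)
      + (\<Sum>l<N - 1. c (Suc (Suc l)) * (c (Suc (Suc l)) * mode_energy N l))"
  proof -
    have "(\<Sum>m\<le>N. c m * E (Suc (Suc l)) m) = c (Suc (Suc l)) * mode_energy N l" if "l < N - 1" for l
    proof -
      have "(\<Sum>m\<le>N. c m * E (Suc (Suc l)) m) = (\<Sum>m\<le>N. if m = Suc (Suc l) then c m * mode_energy N l else 0)"
        using that by (intro sum.cong refl) (simp add: E')
      then show ?thesis using that by simp
    qed
    moreover have "(\<Sum>m\<le>N. c m * E 0 m) = c 1 * alpha 1" "(\<Sum>m\<le>N. c m * E 1 m) = c 0 * alpha 1"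
      using N by (simp_all add: sum_modes E01 E)
    ultimately show ?thesis unfolding sum_modes[OF N] by simp
  qed
  finally show ?thesis by (simp add: power2_eq_square mult_ac)
qed

section \<open>Uniqueness and existence for given reflection factor\<close>

lemma half_space_unique:
  assumes N: "N \<ge> 1" and "\<bar>\<kappa>\<bar> \<le> 1" and "c 1 = c 0"
    and bc: "\<And>k. k \<in> {1..N} \<Longrightarrow> coeff_dist N c (2 * N - k + 1) = \<kappa> * coeff_dist N c k"
    and "i \<le> N"
  shows "c i = 0"
proof -
  let ?f = "coeff_dist N c"
  define g where "g = (\<lambda>j. \<Sum>i\<le>N. c i * mode N i j)"
  define T where "T = (\<Sum>l<N - 1. (c (Suc (Suc l)))\<^sup>2 * mode_energy N l)"
  have T: "T \<ge> 0"
    unfolding T_def by (intro sum_nonneg mult_nonneg_nonneg) (auto simp: less_imp_le mode_energy_pos)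
  have "2 * alpha 1 * c 0 * c 1 + T = (\<Sum>j<2 * N. g j * A_op N g j)"
    unfolding T_def using energy_modes[OF N g_def] by simp
  also have "\<dots> = (\<Sum>k=1..2 * N. velocity N k * kernel_at N k * (?f k)\<^sup>2)"
    by (rule energy_velocities[OF N]) (simp add: coeff_dist_eq g_def)
  \<comment> \<open>Mirror velocities have opposite sign and equal \<open>kernel_at\<close>, so the
    reflection condition leaves the factor \<open>1 - \<kappa>\<^sup>2\<close> for each
    pair.\<close>
  also have "\<dots> = (\<Sum>k=1..N. velocity N k * kernel_at N k * (1 - \<kappa>\<^sup>2) * (?f k)\<^sup>2)"
    unfolding sum_velocities_reflect
  proof (intro sum.cong refl)
    fix k assume k: "k \<in> {1..N}"
    then have k': "k \<in> {1..2 * N}" by auto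
    show "velocity N k * kernel_at N k * (?f k)\<^sup>2
        + velocity N (2 * N - k + 1) * kernel_at N (2 * N - k + 1) * (?f (2 * N - k + 1))\<^sup>2
      = velocity N k * kernel_at N k * (1 - \<kappa>\<^sup>2) * (?f k)\<^sup>2"
      unfolding velocity_reflect[OF k'] kernel_at_reflect[OF k'] bc[OF k]
      by (simp add: power_mult_distrib algebra_simps)
  qed
  also have "\<dots> \<le> 0"
  proof (rule sum_nonpos)
    fix k assume "k \<in> {1..N}"
    then have "velocity N k * kernel_at N k \<le> 0"
      using velocity_neg[of k N] kernel_at_pos[OF N, of k] by (simp add: mult_nonpos_nonneg)
    moreover have "1 - \<kappa>\<^sup>2 \<ge> 0" using assms(2) by (simp add: abs_square_le_1)
    ultimately show "velocity N k * kernel_at N k * (1 - \<kappa>\<^sup>2) * (?f k)\<^sup>2 \<le> 0"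
      by (simp add: mult_nonpos_nonneg)
  qed
  \<comment> \<open>By \<open>c 1 = c 0\<close> the mixed term of the constant modes is a square, so
    a sum of nonnegative terms is at most 0.\<close>
  finally have le: "2 * alpha 1 * (c 0)\<^sup>2 + T \<le> 0" using assms(3) by (simp add: power2_eq_square mult_ac)
  have a: "alpha 1 > 0" using alpha_pos[of 1] by simp
  then have "2 * alpha 1 * (c 0)\<^sup>2 \<ge> 0" by simp
  with le T have "T = 0" and c0: "2 * alpha 1 * (c 0)\<^sup>2 = 0" by linarith+
  then have "(c (Suc (Suc l)))\<^sup>2 * mode_energy N l = 0" if "l < N - 1" for l
    using that unfolding T_def by (subst (asm) sum_nonneg_eq_0_iff) (auto simp: less_imp_le mode_energy_pos)
  then have "c (Suc (Suc l)) = 0" if "l < N - 1" for l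
    using mode_energy_pos[OF that] that by fastforce
  moreover have "c 0 = 0" using c0 a by simp
  ultimately show ?thesis using assms(3,5) by (auto elim!: mode_cases)
qed

text \<open>A square linear system: its kernel is trivial by uniqueness for data 0, so it is
  solvable.\<close>

lemma half_space_exists:
  assumes N: "N \<ge> 1" and "\<bar>\<kappa>\<bar> \<le> 1"
  obtains c where "c 1 - c 0 = s" "\<And>k. k \<in> {1..N} \<Longrightarrow> coeff_dist N c (2 * N - k + 1) = \<kappa> * coeff_dist N c k"
proof -
  \<comment> \<open>Row 0 prescribes the characteristic; rows \<open>1..N\<close> keep the velocity
    numbers and hold the reflection conditions.\<close>
  define M where "M = mat (N + 1) (N + 1) (\<lambda>(k, i). if k = 0 then (if i = 1 then 1 else if i = 0 then - 1 else 0)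
    else mode_dist N i (2 * N - k + 1) - \<kappa> * mode_dist N i k)"
  have M: "M \<in> carrier_mat (N + 1) (N + 1)" by (simp add: M_def)
  have row0: "(M *\<^sub>v w) $ 0 = w $ 1 - w $ 0" if "w \<in> carrier_vec (N + 1)" for w
  proof -
    have "(M *\<^sub>v w) $ 0 = (\<Sum>i\<le>N. (if i = 1 then 1 else if i = 0 then - 1 else 0) * w $ i)"
      using that by (simp add: M_def scalar_prod_def lessThan_Suc_atMost flip: lessThan_atLeast0)
    then show ?thesis by (simp add: sum_modes[OF N])
  qed
  have row: "(M *\<^sub>v w) $ k = coeff_dist N (\<lambda>i. w $ i) (2 * N - k + 1) - \<kappa> * coeff_dist N (\<lambda>i. w $ i) k"
    if "w \<in> carrier_vec (N + 1)" "k \<in> {1..N}" for w k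
  proof -
    have "(M *\<^sub>v w) $ k = (\<Sum>i\<le>N. (mode_dist N i (2 * N - k + 1) - \<kappa> * mode_dist N i k) * w $ i)"
      using that by (simp add: M_def scalar_prod_def lessThan_Suc_atMost flip: lessThan_atLeast0)
    then show ?thesis
      by (simp add: coeff_dist_def algebra_simps sum_subtractf sum_distrib_left)
  qed
  have "det M \<noteq> 0"
  proof
    assume "det M = 0"
    then obtain w where w: "w \<in> carrier_vec (N + 1)" "w \<noteq> 0\<^sub>v (N + 1)" "M *\<^sub>v w = 0\<^sub>v (N + 1)"
      using det_0_iff_vec_prod_zero[OF M] by blast
    have "w $ i = 0" if "i \<le> N" for i
    proof (rule half_space_unique[OF assms, of "\<lambda>i. w $ i", OF _ _ that])
      show "w $ 1 = w $ 0" using row0[OF w(1)] w(3) by simp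
      show "coeff_dist N (\<lambda>i. w $ i) (2 * N - k + 1) = \<kappa> * coeff_dist N (\<lambda>i. w $ i) k" if "k \<in> {1..N}" for k
        using row[OF w(1) that] w(3) that by simp
    qed
    then have "w = 0\<^sub>v (N + 1)" using w(1) by (intro eq_vecI) auto
    with w(2) show False by simp
  qed
  from det_non_zero_imp_unit[OF M this, of "()"]
  obtain B where B: "B \<in> carrier_mat (N + 1) (N + 1)" "M * B = 1\<^sub>m (N + 1)"
    unfolding Units_def by (auto simp: ring_mat_simps)
  define w where "w = B *\<^sub>v vec (N + 1) (\<lambda>k. if k = 0 then s else 0)"
  have w: "w \<in> carrier_vec (N + 1)" using B by (simp add: w_def)
  have "M *\<^sub>v w = (M * B) *\<^sub>v vec (N + 1) (\<lambda>k. if k = 0 then s else 0)"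
    unfolding w_def using M B by (subst assoc_mult_mat_vec) auto
  then have "M *\<^sub>v w = vec (N + 1) (\<lambda>k. if k = 0 then s else 0)"
    using B by simp
  then show ?thesis
    using row0[OF w] row[OF w] by (intro that[of "\<lambda>i. w $ i"]) auto
qed

section \<open>The coupled problem\<close>

text \<open>Both \<open>q_inf\<close> and the density term carry the factor \<open>alpha 1\<close>,
  so prescribing the characteristic fixes \<open>c 1 - c 0\<close>.\<close>

lemma characteristic_mode_sum:
  assumes "\<And>x. x \<ge> 0 \<Longrightarrow> G x = mode_sum N c x" "N \<ge> 1"
  shows "q_inf G - alpha 1 * rho_inf G = sqrt 2 * alpha 1 * (c 1 - c 0)"
  using Lim_mode_sum[OF assms, of 0] Lim_mode_sum[OF assms, of 1]
  by (simp add: q_inf_def rho_inf_def algebra_simps)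

text \<open>The family and its members are extensional, so that uniqueness concerns only the edges
  \<open>1..n\<close> and the half line.\<close>

theorem theorem6p1:
  fixes N n :: nat and r :: "nat \<Rightarrow> real"
  assumes "N \<ge> 1" and "n \<ge> 3"
  shows "\<exists>!G. G \<in> {1..n} \<rightarrow>\<^sub>E ({0..} \<rightarrow>\<^sub>E carrier_vec (2 * N)) \<and>
           (\<forall>i\<in>{1..n}. bounded_solution N (G i)) \<and>
           (\<forall>i\<in>{1..n}. q_inf (G i) - alpha 1 * rho_inf (G i) = r i) \<and>
           kinetic_coupling N n G"
proof (rule ex_ex1I)
  let ?a = "sqrt 2 * alpha 1"
  \<comment> \<open>For the difference \<open>d\<close> of the distributions on edges 1 and
    \<open>i\<close>, the second coupling condition says that \<open>n - 1\<close> times the mirror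
    value of \<open>d\<close> plus \<open>d\<close> itself is 0: a reflection with factor
    \<kappa>.\<close>
  define \<kappa> where "\<kappa> = - 1 / (real n - 1)"
  have n: "real n - 1 > 0" "real n > 0" using assms(2) by auto
  have \<kappa>: "\<bar>\<kappa>\<bar> \<le> 1" using assms(2) by (simp add: \<kappa>_def)
  have a: "?a \<noteq> 0" using alpha_pos[of 1] by simp
  define s where "s = (\<lambda>i. r i / ?a)"
  \<comment> \<open>\<open>u\<close> will be the sum of all edges: it receives the total
    characteristic and, by the first coupling condition, the factor 1.\<close>
  obtain u where u: "u 1 - u 0 = (\<Sum>j=1..n. s j)"
    "\<And>k. k \<in> {1..N} \<Longrightarrow> coeff_dist N u (2 * N - k + 1) = 1 * coeff_dist N u k"
    using half_space_exists[OF assms(1), of 1] by (metis abs_one order_refl)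
  \<comment> \<open>\<open>e i\<close> will be the deviation of edge \<open>i\<close> from the
    average \<open>u / n\<close>; it carries the remaining characteristic.\<close>
  have "\<exists>e. e 1 - e 0 = s i - (\<Sum>j=1..n. s j) / n \<and>
      (\<forall>k\<in>{1..N}. coeff_dist N e (2 * N - k + 1) = \<kappa> * coeff_dist N e k)" for i
    using half_space_exists[OF assms(1) \<kappa>] by (metis (no_types, lifting))
  then obtain e where e: "\<And>i. e i 1 - e i 0 = s i - (\<Sum>j=1..n. s j) / n"
    "\<And>i k. k \<in> {1..N} \<Longrightarrow> coeff_dist N (e i) (2 * N - k + 1) = \<kappa> * coeff_dist N (e i) k"
    by metis
  \<comment> \<open>The deviations have total characteristic 0, so by uniqueness they cancel and
    \<open>u\<close> is indeed the sum.\<close>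
  have e_sum: "(\<Sum>j=1..n. e j l) = 0" if "l \<le> N" for l
  proof (rule half_space_unique[OF assms(1) \<kappa>, of "\<lambda>l. \<Sum>j=1..n. e j l", OF _ _ that])
    have "(\<Sum>j=1..n. e j 1) - (\<Sum>j=1..n. e j 0) = (\<Sum>j=1..n. s j - (\<Sum>j=1..n. s j) / n)"
      unfolding sum_subtractf[symmetric] e ..
    also have "\<dots> = 0" using n by (simp add: sum_subtractf)
    finally show "(\<Sum>j=1..n. e j 1) = (\<Sum>j=1..n. e j 0)" by simp
    show "coeff_dist N (\<lambda>l. \<Sum>j=1..n. e j l) (2 * N - k + 1) = \<kappa> * coeff_dist N (\<lambda>l. \<Sum>j=1..n. e j l) k"
      if "k \<in> {1..N}" for k
      unfolding coeff_dist_sum e(2)[OF that] sum_distrib_left ..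
  qed
  define c where "c = (\<lambda>i l. u l / n + e i l)"
  define G where "G = (\<lambda>i\<in>{1..n}. \<lambda>x\<in>{0..}. mode_sum N (c i) x)"
  have G: "G i x = mode_sum N (c i) x" if "i \<in> {1..n}" "x \<ge> 0" for i x
    using that by (simp add: G_def)
  have dist: "node_dist N (G i) k = coeff_dist N u k / n + coeff_dist N (e i) k"
    if "i \<in> {1..n}" "k \<in> {1..2 * N}" for i k
  proof -
    have "node_dist N (G i) k = coeff_dist N (c i) k"
      by (rule node_dist_mode_sum[of "G i", OF G[OF that(1) order_refl] assms(1) that(2)])
    then show ?thesis by (simp add: c_def coeff_dist_add coeff_dist_divide)
  qed
  have dist_sum: "(\<Sum>j=1..n. node_dist N (G j) k) = coeff_dist N u k" if "k \<in> {1..2 * N}" for k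
  proof -
    have "(\<Sum>j=1..n. node_dist N (G j) k) = (\<Sum>j=1..n. coeff_dist N u k / n) + (\<Sum>j=1..n. coeff_dist N (e j) k)"
      unfolding sum.distrib[symmetric] using dist[OF _ that] by (intro sum.cong refl) auto
    also have "(\<Sum>j=1..n. coeff_dist N (e j) k) = 0"
      unfolding coeff_dist_sum[symmetric] by (rule coeff_dist_eq_0) (rule e_sum)
    finally show ?thesis using n by simp
  qed
  have "kinetic_coupling N n G"
    unfolding kinetic_coupling_def
  proof (intro conjI ballI)
    fix k assume k: "k \<in> {1..N}"
    then have k': "k \<in> {1..2 * N}" "2 * N - k + 1 \<in> {1..2 * N}" by auto
    show "(\<Sum>j=1..n. node_dist N (G j) (2 * N - k + 1)) = (\<Sum>j=1..n. node_dist N (G j) k)"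
      using dist_sum[OF k'(1)] dist_sum[OF k'(2)] u(2)[OF k] by simp
    \<comment> \<open>The common value is the same for every edge, since with this \<kappa> the
      contribution of \<open>e i\<close> drops out.\<close>
    have *: "(real n - 1) * node_dist N (G i) (2 * N - k + 1) + node_dist N (G i) k = coeff_dist N u k"
      if "i \<in> {1..n}" for i
    proof -
      have "(real n - 1) * node_dist N (G i) (2 * N - k + 1) + node_dist N (G i) k
        = (real n - 1) * (coeff_dist N u k / n + \<kappa> * coeff_dist N (e i) k) + (coeff_dist N u k / n + coeff_dist N (e i) k)"
        unfolding dist[OF that k'(1)] dist[OF that k'(2)] u(2)[OF k] e(2)[OF k] by simp
      also have "\<dots> = real n * (coeff_dist N u k / n) + ((real n - 1) * \<kappa> + 1) * coeff_dist N (e i) k"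
        by (simp only: algebra_simps)
      also have "(real n - 1) * \<kappa> + 1 = 0" using n by (simp add: \<kappa>_def)
      finally show ?thesis using n by simp
    qed
    fix i assume i: "i \<in> {2..n}"
    show "(real n - 1) * node_dist N (G 1) (2 * N - k + 1) + node_dist N (G 1) k =
        (real n - 1) * node_dist N (G i) (2 * N - k + 1) + node_dist N (G i) k"
      using *[of 1] *[of i] i by simp
  qed
  moreover have "bounded_solution N (G i)" if "i \<in> {1..n}" for i
    using G[OF that] by (rule bounded_solution_mode_sum)
  moreover have "q_inf (G i) - alpha 1 * rho_inf (G i) = r i" if "i \<in> {1..n}" for i
  proof -
    have "c i 1 - c i 0 = (u 1 - u 0) / n + (e i 1 - e i 0)" by (simp add: c_def diff_divide_distrib)
    then have "c i 1 - c i 0 = s i" unfolding u(1) e(1) by simp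
    then show ?thesis
      using characteristic_mode_sum[of "G i" N "c i", OF G[OF that] assms(1)] a by (simp add: s_def del: One_nat_def)
  qed
  moreover have "G \<in> {1..n} \<rightarrow>\<^sub>E ({0..} \<rightarrow>\<^sub>E carrier_vec (2 * N))"
    by (auto simp: G_def)
  ultimately show "\<exists>G. G \<in> {1..n} \<rightarrow>\<^sub>E ({0..} \<rightarrow>\<^sub>E carrier_vec (2 * N)) \<and>
      (\<forall>i\<in>{1..n}. bounded_solution N (G i)) \<and>
      (\<forall>i\<in>{1..n}. q_inf (G i) - alpha 1 * rho_inf (G i) = r i) \<and> kinetic_coupling N n G"
    by blast
next
  fix G H
  let ?P = "\<lambda>G. G \<in> {1..n} \<rightarrow>\<^sub>E ({0..} \<rightarrow>\<^sub>E carrier_vec (2 * N)) \<and>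
      (\<forall>i\<in>{1..n}. bounded_solution N (G i)) \<and>
      (\<forall>i\<in>{1..n}. q_inf (G i) - alpha 1 * rho_inf (G i) = r i) \<and> kinetic_coupling N n G"
  assume PG: "?P G" and PH: "?P H"
  have n: "real n - 1 > 0" using assms(2) by simp
  have a: "sqrt 2 * alpha 1 \<noteq> 0" using alpha_pos[of 1] by simp
  have ex: "\<exists>c. \<forall>i\<in>{1..n}. \<forall>x\<ge>0. F i x = mode_sum N (c i) x" if "?P F" for F
  proof -
    have "\<exists>c. \<forall>x\<ge>0. F i x = mode_sum N c x" if "i \<in> {1..n}" for i
      using bounded_solution_imp_mode_sum[OF assms(1), of "F i"] \<open>?P F\<close> that by metis
    then show ?thesis by metis
  qed
  obtain c d where c: "\<And>i x. i \<in> {1..n} \<Longrightarrow> x \<ge> 0 \<Longrightarrow> G i x = mode_sum N (c i) x"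
    and d: "\<And>i x. i \<in> {1..n} \<Longrightarrow> x \<ge> 0 \<Longrightarrow> H i x = mode_sum N (d i) x"
    using ex[OF PG] ex[OF PH] by metis
  \<comment> \<open>By linearity the difference of two solutions has characteristics 0 and satisfies
    the coupling conditions.\<close>
  define D where "D = (\<lambda>i l. c i l - d i l)"
  have D_dist: "coeff_dist N (D i) k = node_dist N (G i) k - node_dist N (H i) k"
    if "i \<in> {1..n}" "k \<in> {1..2 * N}" for i k
    using node_dist_mode_sum[of "G i", OF c[OF that(1) order_refl] assms(1) that(2)]
      node_dist_mode_sum[of "H i", OF d[OF that(1) order_refl] assms(1) that(2)]
    by (simp add: D_def coeff_dist_diff)
  have D01: "D i 1 = D i 0" if "i \<in> {1..n}" for i
  proof -
    have "sqrt 2 * alpha 1 * (c i 1 - c i 0) = sqrt 2 * alpha 1 * (d i 1 - d i 0)"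
      using characteristic_mode_sum[of "G i" N "c i", OF c[OF that] assms(1)] characteristic_mode_sum[of "H i" N "d i", OF d[OF that] assms(1)]
        PG PH that by simp
    then have "c i 1 - c i 0 = d i 1 - d i 0" unfolding mult_left_cancel[OF a] .
    then show ?thesis by (simp add: D_def)
  qed
  \<comment> \<open>The sum over all edges reflects with factor 1.\<close>
  have D_sum: "(\<Sum>j=1..n. D j l) = 0" if "l \<le> N" for l
  proof (rule half_space_unique[OF assms(1), of 1 "\<lambda>l. \<Sum>j=1..n. D j l", OF _ _ _ that])
    show "(\<Sum>j=1..n. D j 1) = (\<Sum>j=1..n. D j 0)" by (intro sum.cong refl D01)
    fix k assume k: "k \<in> {1..N}"
    then have k': "k \<in> {1..2 * N}" "2 * N - k + 1 \<in> {1..2 * N}" by auto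
    have *: "coeff_dist N (\<lambda>l. \<Sum>j=1..n. D j l) m
        = (\<Sum>j=1..n. node_dist N (G j) m) - (\<Sum>j=1..n. node_dist N (H j) m)" if "m \<in> {1..2 * N}" for m
      unfolding coeff_dist_sum sum_subtractf[symmetric] using that by (intro sum.cong refl D_dist) auto
    show "coeff_dist N (\<lambda>l. \<Sum>j=1..n. D j l) (2 * N - k + 1) = 1 * coeff_dist N (\<lambda>l. \<Sum>j=1..n. D j l) k"
      unfolding *[OF k'(1)] *[OF k'(2)]
      using PG PH k unfolding kinetic_coupling_def by (simp del: One_nat_def)
  qed simp
  have D_diff: "D 1 l - D i l = 0" if i: "i \<in> {1..n}" and l: "l \<le> N" for i l
  proof (rule half_space_unique[OF assms(1), of "- 1 / (real n - 1)" "\<lambda>l. D 1 l - D i l", OF _ _ _ l])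
    have one: "1 \<in> {1..n}" using assms(2) by simp
    show "D 1 1 - D i 1 = D 1 0 - D i 0" using D01[OF i] D01[OF one] by simp
    fix k assume k: "k \<in> {1..N}"
    then have k': "k \<in> {1..2 * N}" "2 * N - k + 1 \<in> {1..2 * N}" by auto
    have coup: "(real n - 1) * node_dist N (F 1) (2 * N - k + 1) + node_dist N (F 1) k =
        (real n - 1) * node_dist N (F i) (2 * N - k + 1) + node_dist N (F i) k" if "?P F" for F
    proof (cases "i = 1")
      case False
      then have "i \<in> {2..n}" using i by auto
      then show ?thesis using that k unfolding kinetic_coupling_def by blast
    qed simp
    have "(real n - 1) * coeff_dist N (\<lambda>l. D 1 l - D i l) (2 * N - k + 1) = - coeff_dist N (\<lambda>l. D 1 l - D i l) k"
      unfolding coeff_dist_diff D_dist[OF i k'(1)] D_dist[OF i k'(2)] D_dist[OF one k'(1)] D_dist[OF one k'(2)]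
      using coup[OF PG] coup[OF PH] by (simp add: algebra_simps)
    then show "coeff_dist N (\<lambda>l. D 1 l - D i l) (2 * N - k + 1) = - 1 / (real n - 1) * coeff_dist N (\<lambda>l. D 1 l - D i l) k"
      using n by (simp add: field_simps)
  qed (use assms(2) in simp)
  have D_0: "D i l = 0" if "i \<in> {1..n}" "l \<le> N" for i l
  proof -
    \<comment> \<open>All \<open>D j\<close> agree with \<open>D 1\<close>, so the vanishing sum is
      \<open>n\<close> times \<open>D 1\<close>.\<close>
    have "(\<Sum>j=1..n. D j l) = (\<Sum>j=1..n. D 1 l)"
      by (intro sum.cong refl) (use D_diff[OF _ that(2)] in auto)
    then have "D 1 l = 0" using D_sum[OF that(2)] n by simp
    then show ?thesis using D_diff[OF that] by simp
  qed
  have "G i x = H i x" if "i \<in> {1..n}" "x \<in> {0..}" for i x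
  proof -
    have "mode_sum N (c i) x = mode_sum N (d i) x"
      unfolding mode_sum_def
      by (intro arg_cong[of _ _ "vec (2 * N)"] ext sum.cong refl) (use D_0[OF that(1)] in \<open>simp add: D_def\<close>)
    then show ?thesis using c[OF that(1)] d[OF that(1)] that(2) by simp
  qed
  then have "G i = H i" if "i \<in> {1..n}" for i
    using PG PH that by (intro PiE_ext[of "G i" "{0..}" "\<lambda>_. carrier_vec (2 * N)" "H i"]) (auto simp: PiE_iff)
  then show "G = H"
    using PG PH by (intro PiE_ext[of G "{1..n}" "\<lambda>_. {0..} \<rightarrow>\<^sub>E carrier_vec (2 * N)" H]) auto
qed

end
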